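(* For $X>0$ let $R(X)$ be the number of real quadratic fields $K$ with discriminant $\Delta_K \le X$ such that there exists an elliptic curve $E/K$ with everywhere good reduction over $K$ and rational $j$-invariant $j(E)\in\mathbb{Q}$. Then $$R(X) \gg \frac{X}{\sqrt{\log X}}.$$
   Context: An elliptic curve $E/K$ over a number field $K$ has everywhere good reduction if it has good reduction at every prime of $\mathcal{O}_K$. *)

theory Defs
  imports Complex_Main "HOL-Computational_Algebra.Polynomial" "HOL-Computational_Algebra.Squarefree"
begin

text \<open>Real quadratic fields are exactly Q(sqrt d) for squarefree integers d > 1 (bijectively).
  We realise Q(sqrt d) as a subfield of the reals.\<close>

definition qfield :: "int \<Rightarrow> real set" where
  "qfield d = {x. \<exists>a b :: rat. x = of_rat a + of_rat b * sqrt (real_of_int d)}"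

definition field_disc :: "int \<Rightarrow> int" where
  "field_disc d = (if d mod 4 = 1 then d else 4 * d)"

definition alg_int :: "real \<Rightarrow> bool" where
  "alg_int x \<longleftrightarrow> (\<exists>p :: int poly. lead_coeff p = 1 \<and> poly (map_poly of_int p) x = 0)"

definition ring_of_integers :: "int \<Rightarrow> real set" where
  "ring_of_integers d = {x \<in> qfield d. alg_int x}"

definition prime_ideal_OK :: "int \<Rightarrow> real set \<Rightarrow> bool" where
  "prime_ideal_OK d P \<longleftrightarrow>
     P \<subseteq> ring_of_integers d \<and> 0 \<in> P \<and>
     (\<forall>x\<in>P. \<forall>y\<in>P. x + y \<in> P) \<and>
     (\<forall>x\<in>P. \<forall>r\<in>ring_of_integers d. r * x \<in> P) \<and>
     P \<noteq> {0} \<and> P \<noteq> ring_of_integers d \<and>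
     (\<forall>x\<in>ring_of_integers d. \<forall>y\<in>ring_of_integers d. x * y \<in> P \<longrightarrow> x \<in> P \<or> y \<in> P)"

definition local_ring :: "int \<Rightarrow> real set \<Rightarrow> real set" where
  "local_ring d P = {x \<in> qfield d. \<exists>s \<in> ring_of_integers d - P. s * x \<in> ring_of_integers d}"

text \<open>Weierstrass equations y^2 + a1 xy + a3 y = x^3 + a2 x^2 + a4 x + a6,
  coefficients (a1,a2,a3,a4,a6).\<close>
type_synonym weier = "real \<times> real \<times> real \<times> real \<times> real"

fun w_disc :: "weier \<Rightarrow> real" where
  "w_disc (a1, a2, a3, a4, a6) =
    (let b2 = a1^2 + 4*a2; b4 = 2*a4 + a1*a3; b6 = a3^2 + 4*a6;
         b8 = a1^2*a6 + 4*a2*a6 - a1*a3*a4 + a2*a3^2 - a4^2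
     in -(b2^2*b8) - 8*b4^3 - 27*b6^2 + 9*b2*b4*b6)"

fun w_c4 :: "weier \<Rightarrow> real" where
  "w_c4 (a1, a2, a3, a4, a6) =
    (let b2 = a1^2 + 4*a2; b4 = 2*a4 + a1*a3 in b2^2 - 24*b4)"

definition j_inv :: "weier \<Rightarrow> real" where
  "j_inv E = w_c4 E ^ 3 / w_disc E"

fun coeffs_in :: "real set \<Rightarrow> weier \<Rightarrow> bool" where
  "coeffs_in S (a1, a2, a3, a4, a6) \<longleftrightarrow> a1 \<in> S \<and> a2 \<in> S \<and> a3 \<in> S \<and> a4 \<in> S \<and> a6 \<in> S"

definition elliptic_curve_over :: "int \<Rightarrow> weier \<Rightarrow> bool" where
  "elliptic_curve_over d E \<longleftrightarrow> coeffs_in (qfield d) E \<and> w_disc E \<noteq> 0"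

text \<open>Standard change of variables x = u^2 x' + r, y = u^3 y' + s u^2 x' + t (Silverman, Table 3.1).\<close>
fun change_vars :: "real \<Rightarrow> real \<Rightarrow> real \<Rightarrow> real \<Rightarrow> weier \<Rightarrow> weier" where
  "change_vars u r s t (a1, a2, a3, a4, a6) =
    ((a1 + 2*s) / u,
     (a2 - s*a1 + 3*r - s^2) / u^2,
     (a3 + r*a1 + 2*t) / u^3,
     (a4 - s*a3 + 2*r*a2 - (t + r*s)*a1 + 3*r^2 - 2*s*t) / u^4,
     (a6 + r*a4 + r^2*a2 + r^3 - t*a3 - t^2 - r*t*a1) / u^6)"

definition good_reduction_at :: "int \<Rightarrow> real set \<Rightarrow> weier \<Rightarrow> bool" where
  "good_reduction_at d P E \<longleftrightarrow>
     (\<exists>u r s t. u \<in> qfield d \<and> u \<noteq> 0 \<and> r \<in> qfield d \<and> s \<in> qfield d \<and> t \<in> qfield d \<and>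
        coeffs_in (local_ring d P) (change_vars u r s t E) \<and>
        w_disc (change_vars u r s t E) \<noteq> 0 \<and>
        1 / w_disc (change_vars u r s t E) \<in> local_ring d P)"

definition everywhere_good :: "int \<Rightarrow> weier \<Rightarrow> bool" where
  "everywhere_good d E \<longleftrightarrow> (\<forall>P. prime_ideal_OK d P \<longrightarrow> good_reduction_at d P E)"

definition R_count :: "real \<Rightarrow> nat" where
  "R_count X = card {d :: int. squarefree d \<and> d > 1 \<and> real_of_int (field_disc d) \<le> X \<and>
      (\<exists>E. elliptic_curve_over d E \<and> everywhere_good d E \<and> j_inv E \<in> \<rat>)}"

end

theory Submission
  imports Defs "HOL-Number_Theory.Number_Theory"
begin

text \<open>
  The curve \<open>Y\<^sup>2 = X\<^sup>3 + 4X\<^sup>2 + 2X\<close> has \<open>j = 8000\<close> and complex multiplication by \<open>\<int>[\<surd>-2]\<close>, so it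
  has potentially good reduction everywhere. Its twist by \<open>\<delta> = 2x + \<surd>(2q)\<close>, where
  \<open>q = z\<^sup>2 + 2x\<^sup>2 \<equiv> 3 (mod 8)\<close> is squarefree, has good reduction everywhere over \<open>\<rat>(\<surd>(2q))\<close>: since
  \<open>\<delta>\<close> has norm \<open>-2z\<^sup>2\<close> with \<open>z\<close> odd and prime to \<open>x\<close>, the discriminant \<open>512\<delta>\<^sup>6\<close> is the
  twelfth power of an ideal, and a suitable choice of the sign of \<open>x\<close> settles the prime above 2.

  Every squarefree \<open>q \<equiv> 3 (mod 8)\<close> all of whose primes are 1 or 3 modulo 8 is of this form. These
  primes have density 1/2 (Mertens' theorems for the character of \<open>\<rat>(\<surd>-2)\<close>). Splitting an integer
  into a square, a squarefree product of such primes and a squarefree product of the remaining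
  primes gives \<open>\<Sum> 1/n \<ge> c \<surd>(ln N)\<close> for the sum over admissible \<open>n \<le> N\<close>; multiplying such \<open>n\<close> by one
  large admissible prime turns this into \<open>c x / \<surd>(ln x)\<close> admissible integers up to \<open>x\<close>.
\<close>

section \<open>Good reduction of a quadratic twist\<close>

text \<open>The order Z[sqrt d]. Explicit elements are kept in it because products and integrality
  are then direct computations.\<close>

definition quad_ints :: "int \<Rightarrow> real set" where
  "quad_ints d = {of_int a + of_int b * sqrt (of_int d) | a b. True}"

lemma quad_intsI: "of_int a + of_int b * sqrt (of_int d) \<in> quad_ints d"
  unfolding quad_ints_def by blast

lemma quad_ints_of_int: "of_int a \<in> quad_ints d"
  using quad_intsI[of a 0 d] by simp

lemma quad_ints_mult:
  assumes "d \<ge> 0" "x \<in> quad_ints d" "y \<in> quad_ints d"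
  shows "x * y \<in> quad_ints d"
proof -
  obtain a b a' b' where x: "x = of_int a + of_int b * sqrt (of_int d)"
    and y: "y = of_int a' + of_int b' * sqrt (of_int d)"
    using assms unfolding quad_ints_def by blast
  have "(r + s * w) * (r' + s' * w) = (r * r' + s * s' * (w * w)) + (r * s' + r' * s) * w"
    for r s r' s' w :: real
    by Groebner_Basis.algebra
  then have "x * y = of_int (a * a' + b * b' * d) + of_int (a * b' + a' * b) * sqrt (of_int d)"
    unfolding x y using assms(1) by simp
  then show ?thesis
    using quad_intsI by metis
qed

lemma quad_ints_power: "d \<ge> 0 \<Longrightarrow> x \<in> quad_ints d \<Longrightarrow> x ^ n \<in> quad_ints d"
  using quad_ints_of_int[of 1 d] by (induction n) (auto intro: quad_ints_mult)

lemma quad_ints_subset_qfield: "quad_ints d \<subseteq> qfield d"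
proof
  fix x assume "x \<in> quad_ints d"
  then obtain a b where "x = of_int a + of_int b * sqrt (of_int d)"
    unfolding quad_ints_def by blast
  then have "x = of_rat (of_int a) + of_rat (of_int b) * sqrt (real_of_int d)"
    by simp
  then show "x \<in> qfield d"
    unfolding qfield_def by blast
qed

lemma qfield_mult_of_rat:
  assumes "x \<in> qfield d"
  shows "of_rat c * x \<in> qfield d"
proof -
  obtain a b where "x = of_rat a + of_rat b * sqrt (of_int d)"
    using assms unfolding qfield_def by blast
  then have "of_rat c * x = of_rat (c * a) + of_rat (c * b) * sqrt (of_int d)"
    by (simp add: of_rat_mult algebra_simps)
  then show ?thesis
    unfolding qfield_def by blast
qed

lemma quad_ints_subset_ring_of_integers:
  assumes "d \<ge> 0"
  shows "quad_ints d \<subseteq> ring_of_integers d"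
proof
  fix x assume x: "x \<in> quad_ints d"
  then obtain a b where ab: "x = of_int a + of_int b * sqrt (of_int d)"
    unfolding quad_ints_def by blast
  have "alg_int x"
    unfolding alg_int_def
  proof (intro exI conjI)
    \<comment> \<open>The characteristic polynomial: trace \<open>2 * a\<close> and norm
      \<open>a^2 - b^2 * d\<close>.\<close>
    let ?p = "[:a^2 - b^2 * d, - 2 * a, 1:] :: int poly"
    show "lead_coeff ?p = 1" by simp
    have "sqrt (of_int d) * sqrt (of_int d) = real_of_int d"
      using assms by simp
    then show "poly (map_poly of_int ?p) x = 0"
      by (simp add: ab map_poly_pCons power2_eq_square algebra_simps)
  qed
  then show "x \<in> ring_of_integers d"
    using x quad_ints_subset_qfield by (auto simp: ring_of_integers_def)
qed

section \<open>Prime ideals and their local rings\<close>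

lemma prime_ideal_OK_zero: "prime_ideal_OK d P \<Longrightarrow> 0 \<in> P"
  unfolding prime_ideal_OK_def by blast

lemma prime_ideal_OK_mult_left:
  "prime_ideal_OK d P \<Longrightarrow> x \<in> P \<Longrightarrow> r \<in> ring_of_integers d \<Longrightarrow> r * x \<in> P"
  unfolding prime_ideal_OK_def by blast

lemma prime_ideal_OK_add: "prime_ideal_OK d P \<Longrightarrow> x \<in> P \<Longrightarrow> y \<in> P \<Longrightarrow> x + y \<in> P"
  unfolding prime_ideal_OK_def by blast

lemma prime_ideal_OK_one:
  assumes P: "prime_ideal_OK d P"
  shows "1 \<notin> P"
proof
  assume "1 \<in> P"
  then have "r * 1 \<in> P" if "r \<in> ring_of_integers d" for r
    using P that unfolding prime_ideal_OK_def by blast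
  then have "P = ring_of_integers d"
    using P unfolding prime_ideal_OK_def by auto
  then show False using P unfolding prime_ideal_OK_def by blast
qed

lemma prime_ideal_OK_prime:
  "prime_ideal_OK d P \<Longrightarrow> x * y \<in> P \<Longrightarrow> x \<in> ring_of_integers d \<Longrightarrow>
    y \<in> ring_of_integers d \<Longrightarrow>
    x \<in> P \<or> y \<in> P"
  unfolding prime_ideal_OK_def by blast

lemma prime_ideal_OK_power:
  assumes P: "prime_ideal_OK d P" and d: "d \<ge> 0" and x: "x \<in> quad_ints d" and "x ^ n \<in> P"
  shows "x \<in> P"
  using assms(4)
proof (induction n)
  case 0
  then show ?case using prime_ideal_OK_one[OF P] by simp
next
  case (Suc n)
  then have "x \<in> P \<or> x ^ n \<in> P"
    using prime_ideal_OK_prime[OF P, of x "x ^ n"] quad_ints_power[OF d x] x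
      quad_ints_subset_ring_of_integers[OF d] by auto
  then show ?case using Suc.IH by blast
qed

text \<open>Bezout's identity would put 1 into \<open>P\<close>.\<close>

lemma prime_ideal_OK_coprime:
  assumes P: "prime_ideal_OK d P" and d: "d \<ge> 0" and ab: "coprime a b"
    and a: "of_int a \<in> P" and b: "of_int b \<in> P"
  shows False
proof -
  have int: "of_int k \<in> ring_of_integers d" for k
    using quad_ints_of_int quad_ints_subset_ring_of_integers[OF d] by blast
  obtain u v where "u * a + v * b = 1"
    using ab bezout_int[of a b] by (metis coprime_iff_gcd_eq_1)
  then have "of_int u * of_int a + of_int v * of_int b = (1 :: real)"
    by (metis of_int_1 of_int_add of_int_mult)
  moreover have "of_int u * of_int a + of_int v * of_int b \<in> P"
    by (intro prime_ideal_OK_add[OF P] prime_ideal_OK_mult_left[OF P] a b int)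
  ultimately show False
    using prime_ideal_OK_one[OF P] by simp
qed

lemma quad_ints_subset_local_ring:
  assumes P: "prime_ideal_OK d P" and d: "d \<ge> 0"
  shows "quad_ints d \<subseteq> local_ring d P"
proof
  fix x assume x: "x \<in> quad_ints d"
  have "1 \<in> ring_of_integers d - P"
    using prime_ideal_OK_one[OF P] quad_ints_of_int[of 1 d]
      quad_ints_subset_ring_of_integers[OF d] by auto
  moreover have "1 * x \<in> ring_of_integers d" "x \<in> qfield d"
    using x quad_ints_subset_ring_of_integers[OF d] by (auto simp: ring_of_integers_def)
  ultimately show "x \<in> local_ring d P"
    unfolding local_ring_def by blast
qed

text \<open>\<open>D\<close> itself is the denominator outside \<open>P\<close> that places
  \<open>1 / D\<close> in the local ring. The cofactor \<open>y\<close>, in applications a power of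
  the conjugate, shows that \<open>1 / D = y / n\<close> lies in the field.\<close>

lemma good_reduction_atI:
  assumes P: "prime_ideal_OK d P" and d: "d \<ge> 0"
    and urst: "u \<in> qfield d" "u \<noteq> 0" "r \<in> qfield d" "s \<in> qfield d" "t \<in> qfield d"
    and int: "coeffs_in (quad_ints d) (change_vars u r s t E)"
    and disc: "w_disc (change_vars u r s t E) = D" "D \<in> quad_ints d" "D \<notin> P"
    and inv: "D * y = of_int n" "n \<noteq> 0" "y \<in> quad_ints d"
  shows "good_reduction_at d P E"
proof -
  have D: "D \<noteq> 0"
    using disc prime_ideal_OK_zero[OF P] by blast
  have "coeffs_in (local_ring d P) (change_vars u r s t E)"
    using int quad_ints_subset_local_ring[OF P d] by (cases "change_vars u r s t E") auto
  moreover have "1 / D \<in> local_ring d P"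
  proof -
    have "1 / D = of_rat (1 / of_int n) * y"
      using inv D by (simp add: of_rat_divide field_simps)
    then have "1 / D \<in> qfield d"
      using qfield_mult_of_rat inv(3) quad_ints_subset_qfield by (metis subsetD)
    moreover have "D * (1 / D) \<in> ring_of_integers d"
      using D quad_ints_of_int[of 1 d] quad_ints_subset_ring_of_integers[OF d] by auto
    ultimately show ?thesis
      unfolding local_ring_def
      using disc quad_ints_subset_ring_of_integers[OF d] by blast
  qed
  ultimately show ?thesis
    unfolding good_reduction_at_def using urst disc D by metis
qed

section \<open>The twisted curve and its integral models\<close>

lemma w_disc_change_vars_0a0b0:
  assumes "u \<noteq> 0"
  shows "w_disc (change_vars u r s t (0, a, 0, b, 0)) = 16 * b^2 * (a^2 - 4 * b) / u ^ 12"
proof -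
  \<comment> \<open>In terms of \<open>v = 1 / u\<close> the claim is a polynomial identity.\<close>
  define v where "v = 1 / u"
  have *: "change_vars u r s t (0, a, 0, b, 0) =
     (2 * s * v, (a + 3*r - s^2) * v^2, 2 * t * v^3, (b + 2*r*a + 3*r^2 - 2*s*t) * v^4,
      (r*b + r^2*a + r^3 - t^2) * v^6)"
    by (simp add: v_def power_divide)
  show ?thesis
    unfolding * w_disc.simps Let_def
    apply (subst divide_inverse)
    apply (subst power_inverse[symmetric])
    apply (subst inverse_eq_divide[of u, folded v_def])
    by Groebner_Basis.algebra
qed

text \<open>At a prime containing \<open>\<delta>\<close> but not 2 the conjugate \<open>\<delta>'\<close> is a unit, and \<open>\<delta>\<close> equals \<open>-2\<delta>'\<close> up to
  squares. At every other prime, in particular above 2, one explicit integral model with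
  discriminant \<open>(\<delta>\<^sup>2/2)\<^sup>3\<close> works; its integrality is what forces the congruences on \<open>q\<close> and \<open>x\<close>.\<close>

lemma everywhere_good_twist:
  fixes q x z :: int
  defines "w \<equiv> sqrt (of_int (2 * q))"
  defines "\<delta> \<equiv> 2 * of_int x + w"
  assumes q: "q = z^2 + 2 * x^2" and q8: "q mod 8 = 3" and x4: "x mod 4 = 3" and zx: "coprime z x"
  shows "everywhere_good (2 * q) (0, 4 * \<delta>, 0, 2 * \<delta>^2, 0)"
    and "elliptic_curve_over (2 * q) (0, 4 * \<delta>, 0, 2 * \<delta>^2, 0)"
    and "j_inv (0, 4 * \<delta>, 0, 2 * \<delta>^2, 0) \<in> \<rat>"
proof -
  let ?d = "2 * q"
  let ?E = "(0, 4 * \<delta>, 0, 2 * \<delta>^2, 0)"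
  define \<delta>' where "\<delta>' = 2 * of_int x - w"
  \<comment> \<open>\<open>\<eta>\<close> is \<open>\<delta>^2 / 2\<close> and
    \<open>\<eta>'\<close> is its conjugate; their product is \<open>z^4\<close>.\<close>
  define \<eta> where "\<eta> = of_int (2 * x^2 + q) + of_int (2 * x) * w"
  define \<eta>' where "\<eta>' = of_int (2 * x^2 + q) - of_int (2 * x) * w"
  have d: "?d \<ge> 0" using q by simp
  have ww: "w * w = 2 * of_int q" using d unfolding w_def by simp
  have qi: "of_int a + of_int b * w \<in> quad_ints ?d" for a b
    using quad_intsI unfolding w_def .
  have qr: "real_of_int q = of_int z ^ 2 + 2 * of_int x ^ 2"
    using q by simp
  have "odd z"
  proof
    assume "even z"
    then have "even q" using q by simp
    then show False using q8 by presburger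
  qed
  have z: "z \<noteq> 0" using \<open>odd z\<close> by auto
  have \<delta>: "\<delta> \<in> quad_ints ?d" and \<delta>': "\<delta>' \<in> quad_ints ?d"
    and \<eta>: "\<eta> \<in> quad_ints ?d" and \<eta>': "\<eta>' \<in> quad_ints ?d"
    using qi[of "2 * x" 1] qi[of "2 * x" "-1"] qi[of "2 * x^2 + q" "2 * x"] qi[of "2 * x^2 + q" "- 2 * x"]
    by (simp_all add: \<delta>_def \<delta>'_def \<eta>_def \<eta>'_def)
  have \<delta>\<delta>': "\<delta> * \<delta>' = - 2 * of_int z ^ 2"
    unfolding \<delta>_def \<delta>'_def using ww qr by Groebner_Basis.algebra
  have \<eta>\<eta>': "\<eta> * \<eta>' = of_int (z ^ 4)"
    unfolding \<eta>_def \<eta>'_def of_int_power of_int_add of_int_mult of_int_numeral using ww qr by Groebner_Basis.algebra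
  have \<delta>\<eta>: "\<delta>^2 = 2 * \<eta>"
    unfolding \<eta>_def \<delta>_def of_int_power of_int_add of_int_mult of_int_numeral using ww by Groebner_Basis.algebra
  have \<delta>0: "\<delta> \<noteq> 0" "\<delta>' \<noteq> 0" using \<delta>\<delta>' z by auto
  have \<delta>'4: "\<delta> + \<delta>' = 4 * of_int x" by (simp add: \<delta>_def \<delta>'_def)
  have disc: "w_disc (change_vars u r s t ?E) = 512 * \<delta> ^ 6 / u ^ 12" if "u \<noteq> 0" for u r s t
    unfolding w_disc_change_vars_0a0b0[OF that] by (simp add: field_simps)
  have zero: "0 \<in> quad_ints ?d" and one: "1 \<in> quad_ints ?d"
    using quad_ints_of_int[of 0] quad_ints_of_int[of 1] by simp_all
  note qf = quad_ints_subset_qfield[THEN subsetD]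
  have scaled: "2 * \<delta> \<in> quad_ints ?d" if "\<delta> \<in> quad_ints ?d" for \<delta>
    using quad_ints_mult[OF d quad_ints_of_int[of 2] that] by simp
  show "elliptic_curve_over ?d ?E"
  proof -
    have "w_disc ?E = 512 * \<delta> ^ 6"
      using disc[of 1 0 0 0] by simp
    then have "w_disc ?E \<noteq> 0" using \<delta>0 by simp
    moreover have "2 * (2 * \<delta>) \<in> quad_ints ?d" "2 * \<delta>^2 \<in> quad_ints ?d"
      by (intro scaled \<delta> quad_ints_power d)+
    ultimately show ?thesis
      using zero by (auto simp: elliptic_curve_over_def intro: qf)
  qed
  show "j_inv ?E \<in> \<rat>"
  proof -
    have "w_disc ?E = 512 * \<delta> ^ 6"
      using disc[of 1 0 0 0] by simp
    moreover have "w_c4 ?E = 160 * \<delta>^2"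
      by (simp add: field_simps power2_eq_square power4_eq_xxxx)
    ultimately have "j_inv ?E = 8000"
      unfolding j_inv_def using \<delta>0 by (simp add: power_mult_distrib flip: power_mult)
    then show ?thesis by simp
  qed
  \<comment> \<open>Taking \<open>u = 2\<close> divides the discriminant
    \<open>512 * \<delta>^6\<close> by \<open>2^12\<close>, leaving \<open>\<eta>^3\<close>. The
    last coefficient is (2x^2 + 4x + q - 1)/8 + ((x + 1)/4) w; this is where both congruences enter
    in full strength.\<close>
  have model2: "coeffs_in (quad_ints ?d) (change_vars 2 2 w 4 ?E)"
  proof -
    obtain k where k: "x = 4 * k + 3" using x4 by (metis mult_div_mod_eq)
    obtain l where l: "q = 8 * l + 3" using q8 by (metis mult_div_mod_eq)
    have "change_vars 2 2 w 4 ?E =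
      (of_int 0 + of_int 1 * w,
       of_int (2 * x - 4 * l) + of_int 1 * w,
       of_int 1 + of_int 0 * w,
       of_int (8*k^2 + 12*k + 2*l + 6 + 2*x) + of_int (2 * k + 2) * w,
       of_int (4*k^2 + 8*k + l + 4) + of_int (k + 1) * w)"
      using ww unfolding \<delta>_def k l
      by (simp add: field_simps power2_eq_square)
    then show ?thesis
      using qi by (simp only: coeffs_in.simps)
  qed
  show "everywhere_good ?d ?E"
    unfolding everywhere_good_def
  proof (intro allI impI)
    fix P assume P: "prime_ideal_OK ?d P"
    note OKint = quad_ints_subset_ring_of_integers[OF d, THEN subsetD]
    show "good_reduction_at ?d P ?E"
    proof (cases "\<eta> \<in> P")
      case False
      show ?thesis
      proof (rule good_reduction_atI[OF P d _ _ _ _ _ model2])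
        show "w_disc (change_vars 2 2 w 4 ?E) = \<eta> ^ 3"
        proof -
          have "\<delta> ^ 6 = (\<delta>^2) ^ 3" by (simp flip: power_mult)
          also have "\<dots> = 8 * \<eta> ^ 3" unfolding \<delta>\<eta> by (simp add: power_mult_distrib)
          finally show ?thesis by (subst disc) simp_all
        qed
        show "\<eta> ^ 3 * \<eta>' ^ 3 = of_int ((z ^ 4) ^ 3)"
          using \<eta>\<eta>' by (simp flip: power_mult_distrib)
        show "\<eta> ^ 3 \<notin> P"
          using False prime_ideal_OK_power[OF P d \<eta>] by blast
        show "(z ^ 4) ^ 3 \<noteq> 0" using z by simp
      qed (use qi[of 0 1] qi[of 2 0] qi[of 4 0] in \<open>auto intro!: quad_ints_power[OF d] \<eta> \<eta>' qf\<close>)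
    next
      case True
      have "\<eta>' * \<eta> \<in> P"
        by (intro prime_ideal_OK_mult_left[OF P] True OKint \<eta>')
      then have "of_int z ^ 4 \<in> P"
        using \<eta>\<eta>' by (simp add: mult.commute)
      then have zP: "of_int z \<in> P"
        using prime_ideal_OK_power[OF P d quad_ints_of_int] by blast
      \<comment> \<open>The odd integer \<open>z\<close> lies in \<open>P\<close>, so this prime is
        not above 2.\<close>
      have two: "2 \<notin> P"
        using prime_ideal_OK_coprime[OF P d _ zP, of 2] \<open>odd z\<close> by auto
      have "2 * \<eta> \<in> P"
        using prime_ideal_OK_mult_left[OF P True OKint[OF quad_ints_of_int[of 2]]] by simp
      then have \<delta>P: "\<delta> \<in> P"
        using prime_ideal_OK_power[OF P d \<delta>] \<delta>\<eta> by metis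
      \<comment> \<open>The sum of the conjugates is \<open>4 * x\<close>, which is prime to the
        element \<open>z\<close> of \<open>P\<close>.\<close>
      have \<delta>'P: "\<delta>' \<notin> P"
      proof
        assume "\<delta>' \<in> P"
        then have "of_int (4 * x) \<in> P"
          using prime_ideal_OK_add[OF P \<delta>P, of \<delta>'] \<delta>'4 by simp
        moreover have "coprime z (4 * x)"
        proof -
          have "coprime z (2 ^ 2)"
            using \<open>odd z\<close> by (simp only: coprime_power_right_iff coprime_right_2_iff_odd) simp
          then show ?thesis using zx by simp
        qed
        ultimately show False
          using prime_ideal_OK_coprime[OF P d _ zP] by blast
      qed
      \<comment> \<open>The norm relation \<open>\<delta> * \<delta>' = - 2 * z^2\<close> gives
        \<open>\<delta> = - 2 * \<delta>' * u^2\<close> for this \<open>u\<close>. Scaling by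
        \<open>u\<close> thus turns the twist by \<open>\<delta>\<close> into the twist by
        \<open>- 2 * \<delta>'\<close>, whose discriminant \<open>2^15 * \<delta>'^6\<close> is a
        unit at \<open>P\<close>.\<close>
      define u where "u = - \<delta> / (2 * of_int z)"
      have u0: "u \<noteq> 0" using \<delta>0 z by (simp add: u_def)
      have u: "\<delta> = - 2 * \<delta>' * u^2"
      proof -
        have "u * \<delta>' = of_int z"
          using \<delta>\<delta>' z by (simp add: u_def field_simps power2_eq_square)
        moreover have "\<delta> = - 2 * u * of_int z"
          using z by (simp add: u_def)
        ultimately have "\<delta> = - 2 * u * (u * \<delta>')" by simp
        then show ?thesis by (simp add: power2_eq_square mult_ac)
      qed
      have E': "change_vars u 0 0 0 ?E = (0, 4 * (- 2 * \<delta>'), 0, 2 * (- 2 * \<delta>')^2, 0)"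
        unfolding u using u0 by (simp add: power_mult_distrib flip: power_mult)
      have neg: "- 2 * \<delta>' \<in> quad_ints ?d"
        using quad_ints_mult[OF d quad_ints_of_int[of "-2"] \<delta>'] by simp
      show ?thesis
      proof (rule good_reduction_atI[OF P d])
        show "coeffs_in (quad_ints ?d) (change_vars u 0 0 0 ?E)"
          unfolding E' coeffs_in.simps
          using zero scaled[OF scaled[OF neg]] scaled[OF quad_ints_power[OF d neg, of 2]]
          by simp
        show "w_disc (change_vars u 0 0 0 ?E) = 2 ^ 15 * \<delta>' ^ 6"
          unfolding disc[OF u0] using u u0
          by (subst u) (simp add: power_mult_distrib flip: power_mult)
        show "2 ^ 15 * \<delta>' ^ 6 \<in> quad_ints ?d"
          using quad_ints_mult[OF d quad_ints_of_int[of "2^15"] quad_ints_power[OF d \<delta>', of 6]] by simp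
        show "2 ^ 15 * \<delta>' ^ 6 \<notin> P"
        proof
          assume *: "2 ^ 15 * \<delta>' ^ 6 \<in> P"
          have "2 ^ 15 \<in> P \<or> \<delta>' ^ 6 \<in> P"
            using quad_ints_power[OF d quad_ints_of_int[of 2], of 15]
            by (intro prime_ideal_OK_prime[OF P *] OKint quad_ints_power[OF d \<delta>']) simp_all
          then show False
            using prime_ideal_OK_power[OF P d quad_ints_of_int[of 2], of 15]
              prime_ideal_OK_power[OF P d \<delta>', of 6] two \<delta>'P by auto
        qed
        show "2 ^ 15 * \<delta>' ^ 6 * \<delta> ^ 6 = of_int (2 ^ 21 * z ^ 12)"
        proof -
          have "2 ^ 15 * \<delta>' ^ 6 * \<delta> ^ 6 = 2 ^ 15 * (\<delta> * \<delta>') ^ 6"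
            by (simp add: power_mult_distrib)
          then show ?thesis
            unfolding \<delta>\<delta>' by (simp add: power_mult_distrib flip: power_mult)
        qed
        show "u \<in> qfield ?d"
        proof -
          have "u = of_rat (- 1 / (2 * of_int z)) * \<delta>"
            by (simp add: u_def of_rat_divide of_rat_mult of_rat_minus)
          then show ?thesis using qfield_mult_of_rat[OF qf[OF \<delta>]] by simp
        qed
        show "2 ^ 21 * z ^ 12 \<noteq> 0" using z by simp
      qed (use zero u0 in \<open>auto intro!: quad_ints_power[OF d] \<delta> qf\<close>)
    qed
  qed
qed

section \<open>Squarefree numbers of the form \<open>z\<^sup>2 + 2x\<^sup>2\<close>\<close>

lemma card_upper_half: 
  fixes h :: int assumes "h \<ge> 0" shows "card {y. 0 < y \<and> y \<le> h \<and> h < 2 * y} = nat (h - h div 2)"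
proof -
  have "{y. 0 < y \<and> y \<le> h \<and> h < 2 * y} = {h div 2 <.. h}" using assms by auto
  then show ?thesis by simp
qed

text \<open>Gauss's lemma for 2 and Euler's criterion express the symbol as (-1) to the power
  \<open>h + card E\<close> with \<open>h = (p - 1) / 2\<close>; this exponent is even for both
  residues.\<close>

lemma QuadRes_minus_two:
  fixes p :: nat
  assumes p: "prime p" and p8: "p mod 8 = 1 \<or> p mod 8 = 3"
  shows "QuadRes p (- 2)"
proof -
  have "p \<noteq> 2" using p8 by auto
  then have p2: "2 < p" using prime_ge_2_nat[OF p] by simp
  define h where "h = (p - 1) div 2"
  have "odd p" using p p2 prime_odd_nat by blast
  then have h: "p = 2 * h + 1" unfolding h_def by auto
  then have h': "(int p - 1) div 2 = int h" by simp
  interpret GAUSS p 2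
  proof
    show "[2 \<noteq> 0] (mod int p)" using p2 by (auto simp: cong_def)
  qed (use p p2 in auto)
  \<comment> \<open>Doubling 1, ..., \<open>h\<close> stays below \<open>p\<close>, so nothing is
    reduced modulo \<open>p\<close>, and \<open>E\<close> consists of the doubles exceeding
    \<open>h\<close>.\<close>
  have "C = (\<lambda>x. x * 2) ` A"
    unfolding C_def B_def image_image A_def h'
    by (rule image_cong) (use h in auto)
  then have "E = (\<lambda>x. x * 2) ` {y. 0 < y \<and> y \<le> int h \<and> int h < 2 * y}"
    unfolding E_def A_def h' by auto
  then have "card E = card {y. 0 < y \<and> y \<le> int h \<and> int h < 2 * y}"
    by (simp add: card_image inj_on_def)
  then have cE: "card E = h - h div 2"
    by (simp add: card_upper_half)
  have "[2 ^ h = (-1) ^ (card E)] (mod int p)"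
    using pre_gauss_lemma unfolding h' by simp
  then have "[(-1) ^ h * 2 ^ h = (-1) ^ h * (-1) ^ (card E)] (mod int p)"
    by (rule cong_scalar_left)
  moreover have "even (h + card E)"
  proof -
    obtain j where "p = 8 * j + 1 \<or> p = 8 * j + 3"
      using p8 by (metis mult_div_mod_eq)
    then have "h = 4 * j \<or> h = 4 * j + 1"
      using h by auto
    then show ?thesis
      unfolding cE by auto
  qed
  then have "(-1) ^ h * (-1) ^ (card E) = (1 :: int)"
    by (simp flip: power_add)
  moreover have "(-1) ^ h * 2 ^ h = (- 2 :: int) ^ h"
    by (simp flip: power_mult_distrib)
  ultimately have "[(- 2) ^ h = 1] (mod int p)" by simp
  then have "[Legendre (- 2) p = 1] (mod int p)"
    unfolding h_def by (rule cong_trans[OF euler_criterion[OF p p2]])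
  then have "Legendre (- 2) p = 1"
    using p2 by (auto simp: Legendre_def cong_iff_dvd_diff zdvd_not_zless split: if_splits)
  then show ?thesis
    by (auto simp: Legendre_def split: if_splits)
qed

text \<open>Pigeonhole: with \<open>s\<close> the integer part of sqrt p there are
  \<open>(s + 1)^2 > p\<close> pairs in \<open>?S\<close>, so \<open>a - k * b\<close> takes the
  same value modulo \<open>p\<close> at two of them. Their difference is the required pair.\<close>

lemma Thue:
  fixes p :: nat and k :: int
  assumes "p > 0"
  obtains a b :: int where "(a, b) \<noteq> (0, 0)" "a ^ 2 \<le> p" "b ^ 2 \<le> p" "int p dvd a - k * b"
proof -
  define s where "s = nat \<lfloor>sqrt p\<rfloor>"
  have s: "real s \<le> sqrt p" "sqrt p < real (Suc s)"
    by (auto simp: s_def) linarith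
  then have "sqrt p ^ 2 < real (Suc s) ^ 2" "real s ^ 2 \<le> sqrt p ^ 2"
    by (intro power_strict_mono power_mono; simp)+
  then have "real p < real (Suc s ^ 2)" "real (s ^ 2) \<le> real p" by simp_all
  then have s2: "p < Suc s ^ 2" "s ^ 2 \<le> p" by (simp_all only: of_nat_less_iff of_nat_le_iff)
  let ?S = "{0..int s} \<times> {0..int s}"
  let ?f = "\<lambda>(a, b). (a - k * b) mod int p"
  have "?f ` ?S \<subseteq> {0..<int p}" using assms by auto
  then have "card (?f ` ?S) \<le> p" using card_mono[of "{0..<int p}"] by fastforce
  also have "p < card ?S" using s2 by (simp add: power2_eq_square nat_add_distrib)
  finally have "\<not> inj_on ?f ?S" by (rule pigeonhole)
  then obtain a b a' b' where *: "(a, b) \<in> ?S" "(a', b') \<in> ?S" "(a, b) \<noteq> (a', b')"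
     "(a - k * b) mod int p = (a' - k * b') mod int p"
    unfolding inj_on_def by fast
  have bound: "(x - y) ^ 2 \<le> int p" if "x \<in> {0..int s}" "y \<in> {0..int s}" for x y
  proof -
    have "\<bar>x - y\<bar> \<le> int s" using that by auto
    then have "(x - y)^2 \<le> int s ^ 2" by (metis abs_le_square_iff abs_of_nat)
    also have "\<dots> \<le> int p" using s2 by (metis of_nat_le_iff of_nat_power)
    finally show ?thesis .
  qed
  show ?thesis
  proof
    show "(a - a', b - b') \<noteq> (0, 0)" using * by auto
    show "(a - a') ^ 2 \<le> int p" "(b - b') ^ 2 \<le> int p" using bound * by auto
    show "int p dvd a - a' - k * (b - b')"
      using *(4) by (simp add: mod_eq_dvd_iff algebra_simps)
  qed
qed

text \<open>Thue's lemma for a square root \<open>k\<close> of -2 gives a nonzero pair with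
  \<open>a^2 + 2 * b^2 = p * m\<close> and m at most 3. As a prime is not a square, m = 3 is
  impossible; for m = 2 the number \<open>a\<close> is even, and halving exchanges the two
  squares.\<close>

lemma prime_eq_sq_plus_two_sq:
  fixes p :: nat
  assumes p: "prime p" and p8: "p mod 8 = 1 \<or> p mod 8 = 3"
  obtains a b :: int where "int p = a ^ 2 + 2 * b ^ 2"
proof -
  obtain k where k: "[k ^ 2 = - 2] (mod int p)"
    using QuadRes_minus_two[OF assms] by (auto simp: QuadRes_def)
  obtain a b where ab: "(a, b) \<noteq> (0, 0)" "a ^ 2 \<le> int p" "b ^ 2 \<le> int p" "int p dvd a - k * b"
    using Thue prime_gt_0_nat[OF p] by metis
  have "int p dvd k ^ 2 + 2"
    using k by (simp add: cong_iff_dvd_diff)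
  then have "int p dvd (a - k * b) * (a + k * b) + b ^ 2 * (k ^ 2 + 2)"
    by (rule dvd_add[OF dvd_mult2[OF ab(4)] dvd_mult])
  also have "\<dots> = a ^ 2 + 2 * b ^ 2"
    by (simp add: power2_eq_square algebra_simps)
  finally obtain m where m: "a ^ 2 + 2 * b ^ 2 = int p * m" by (rule dvdE)
  have "a ^ 2 \<noteq> int p"
    using p by (metis prime_nat_int_transfer prime_power_iff numeral_eq_one_iff semiring_norm(85))
  then have "int p * m < int p * 3"
    using ab m by linarith
  moreover have "int p * m > 0"
    using ab(1) unfolding m[symmetric] by (auto simp: add_pos_nonneg add_nonneg_pos)
  ultimately have "m = 1 \<or> m = 2"
    using prime_gt_0_nat[OF p] by (auto simp: zero_less_mult_iff)
  then show ?thesis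
  proof
    assume "m = 1"
    then show ?thesis using m that[of a b] by simp
  next
    assume "m = 2"
    then have "a ^ 2 = 2 * (int p - b ^ 2)" using m by simp
    then have "even (a ^ 2)" by simp
    then obtain c where "a = 2 * c" by auto
    then have "int p = b ^ 2 + 2 * c ^ 2" using m \<open>m = 2\<close> by (simp add: power_mult_distrib)
    then show ?thesis using that by blast
  qed
qed

text \<open>Norms from Z[sqrt(-2)] are closed under products (Brahmagupta's identity).\<close>

lemma eq_sq_plus_two_sq:
  fixes n :: nat
  assumes "n > 0" "\<And>p. prime p \<Longrightarrow> p dvd n \<Longrightarrow> p mod 8 = 1 \<or> p mod 8 = 3"
  shows "\<exists>a b :: int. int n = a ^ 2 + 2 * b ^ 2"
  using assms
proof (induction n rule: prime_divisors_induct)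
  case (unit x)
  then have "int x = 1 ^ 2 + 2 * 0 ^ 2" by simp
  then show ?case by blast
next
  case (factor p n)
  obtain a b :: int where ab: "int n = a ^ 2 + 2 * b ^ 2"
    using factor by auto
  obtain c d :: int where cd: "int p = c ^ 2 + 2 * d ^ 2"
    using prime_eq_sq_plus_two_sq[of p] factor by auto
  have "int (p * n) = (a * c - 2 * b * d) ^ 2 + 2 * (a * d + b * c) ^ 2"
    unfolding of_nat_mult ab cd by (simp add: power2_eq_square algebra_simps)
  then show ?case by blast
qed simp

text \<open>Squarefreeness makes any representation primitive. If \<open>b\<close> were even,
  \<open>a^2\<close> would be 3 modulo 8; so \<open>b\<close> is odd, and one of \<open>b\<close>,
  \<open>- b\<close> is 3 modulo 4.\<close>

lemma squarefree_eq_sq_plus_two_sq: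
  fixes n :: nat
  assumes n: "squarefree n" and n8: "n mod 8 = 3"
    and "\<And>p. prime p \<Longrightarrow> p dvd n \<Longrightarrow> p mod 8 = 1 \<or> p mod 8 = 3"
  obtains x z :: int where "int n = z ^ 2 + 2 * x ^ 2" "coprime z x" "x mod 4 = 3"
proof -
  have "n > 0" using n8 by (auto intro: Nat.gr0I)
  then obtain a b :: int where ab: "int n = a ^ 2 + 2 * b ^ 2"
    using eq_sq_plus_two_sq assms(3) by blast
  have "gcd a b ^ 2 dvd int n"
    unfolding ab by (intro dvd_add dvd_mult dvd_power_same) auto
  then have "nat (gcd a b) ^ 2 dvd n"
    by (metis gcd_ge_0_int int_dvd_int_iff nat_0_le of_nat_power)
  then have "is_unit (nat (gcd a b))"
    using n by (auto simp: squarefree_def)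
  then have cop: "coprime a b"
    by (simp add: coprime_iff_gcd_eq_1)
  have "odd b"
  proof
    assume "even b"
    then obtain c where "b = 2 * c" by auto
    then have "int n mod 8 = a ^ 2 mod 8"
      using ab by (simp add: power_mult_distrib)
    then have a8: "a ^ 2 mod 8 = 3" using n8 by (metis of_nat_mod of_nat_numeral)
    have "a ^ 2 mod 8 = (a mod 8) ^ 2 mod 8" by (simp add: power_mod)
    moreover have "a mod 8 \<in> {0..7}" by auto
    then have "a mod 8 \<in> {0,1,2,3,4,5,6,7}" by auto
    ultimately show False using a8 by auto
  qed
  then have "b mod 4 = 3 \<or> (- b) mod 4 = 3" by presburger
  then show ?thesis
    using that[of a b] that[of a "- b"] ab cop by auto
qed

section \<open>Theorems of Chebyshev and Mertens\<close>

lemma sum_greaterThanAtMost_eq_diff: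
  fixes f :: "nat \<Rightarrow> 'a :: ab_group_add"
  assumes "m \<le> n"
  shows "sum f {m<..n} = sum f {1..n} - sum f {1..m}"
proof -
  have "{m<..n} = {1..n} - {1..m}" by auto
  then show ?thesis using assms by (simp add: sum_diff)
qed

lemma ln_Suc_le:
  assumes "n > 0"
  shows "ln (real (Suc n)) \<le> ln (real n) + 1 / n"
proof -
  have "real (Suc n) = n * (1 + 1 / n)" using assms by (simp add: field_simps)
  then have "ln (real (Suc n)) = ln n + ln (1 + 1 / n)"
    using assms by (simp add: ln_mult_pos add_pos_pos del: of_nat_Suc)
  moreover have "ln (1 + 1 / n) \<le> 1 / n" by (intro ln_add_one_self_le_self) simp
  ultimately show ?thesis by simp
qed

lemma sum_divisors_swap:
  fixes g :: "nat \<Rightarrow> nat \<Rightarrow> 'a :: comm_monoid_add"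
  shows "(\<Sum>n\<in>{1..N}. \<Sum>d | d dvd n. g d (n div d)) = (\<Sum>d\<in>{1..N}. \<Sum>k\<in>{1..N div d}. g d k)"
proof -
  have "(\<Sum>n\<in>{1..N}. \<Sum>d | d dvd n. g d (n div d)) =
      (\<Sum>(n, d)\<in>(SIGMA n:{1..N}. {d. d dvd n}). g d (n div d))"
    by (rule sum.Sigma) auto
  also have "\<dots> = (\<Sum>(d, k)\<in>(SIGMA d:{1..N}. {1..N div d}). g d k)"
  proof (rule sum.reindex_bij_witness[of _ "\<lambda>(d, k). (d * k, d)" "\<lambda>(n, d). (d, n div d)"])
    fix x assume "x \<in> (SIGMA d:{1..N}. {1..N div d})"
    then show "(case x of (d, k) \<Rightarrow> (d * k, d)) \<in> (SIGMA n:{1..N}. {d. d dvd n})"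
      by (cases x) (auto simp: less_eq_div_iff_mult_less_eq mult.commute Suc_le_eq
          intro: le_trans[OF _ less_eq_div_iff_mult_less_eq[THEN iffD1]])
  next
    fix x assume "x \<in> (SIGMA n:{1..N}. {d. d dvd n})"
    then obtain n d where "x = (n, d)" "n \<in> {1..N}" "d dvd n" by auto
    moreover from this have "d > 0" "d \<le> n" using dvd_imp_le[of d n] by (auto intro: Nat.gr0I)
    ultimately show "(case x of (n, d) \<Rightarrow> (d, n div d)) \<in> (SIGMA d:{1..N}. {1..N div d})"
      by (auto simp: Suc_le_eq div_le_mono div_greater_zero_iff)
  qed auto
  also have "\<dots> = (\<Sum>d\<in>{1..N}. \<Sum>k\<in>{1..N div d}. g d k)"
    by (rule sum.Sigma [symmetric]) auto
  finally show ?thesis .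
qed

text \<open>The identity that ln is the divisor sum of \<open>mangoldt\<close>, twisted by a
  completely multiplicative \<open>f\<close>. The case \<open>f = 1\<close> gives the factorial
  formula, the case of \<open>\<chi> n / n\<close> gives Mertens' theorem for the character.\<close>

lemma sum_mult_ln_eq_sum_mangoldt:
  fixes f :: "nat \<Rightarrow> real"
  assumes mult: "\<And>a b. f (a * b) = f a * f b"
  shows "(\<Sum>n\<in>{1..N}. f n * ln n) = (\<Sum>d\<in>{1..N}. f d * mangoldt d * (\<Sum>k\<in>{1..N div d}. f k))"
proof -
  have "(\<Sum>n\<in>{1..N}. f n * ln n) =
    (\<Sum>n\<in>{1..N}. \<Sum>d | d dvd n. f d * mangoldt d * f (n div d))"
  proof (rule sum.cong[OF refl])
    fix n assume n: "n \<in> {1..N}"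
    have "f n * ln n = f n * (\<Sum>d | d dvd n. mangoldt d)"
      using mangoldt_sum[of n, where 'a = real] n by simp
    also have "\<dots> = (\<Sum>d | d dvd n. f d * mangoldt d * f (n div d))"
      unfolding sum_distrib_left
    proof (rule sum.cong[OF refl])
      fix d assume "d \<in> {d. d dvd n}"
      then have "f n = f d * f (n div d)" by (metis dvd_mult_div_cancel mem_Collect_eq mult)
      then show "f n * mangoldt d = f d * mangoldt d * f (n div d)" by simp
    qed
    finally show "f n * ln n = (\<Sum>d | d dvd n. f d * mangoldt d * f (n div d))" .
  qed
  also have "\<dots> = (\<Sum>d\<in>{1..N}. \<Sum>k\<in>{1..N div d}. f d * mangoldt d * f k)"
    by (rule sum_divisors_swap)
  finally show ?thesis by (simp add: sum_distrib_left)
qed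

section \<open>Chebyshev's function and its linear upper bound\<close>

definition \<psi> :: "nat \<Rightarrow> real" where
  "\<psi> N = (\<Sum>n\<in>{1..N}. mangoldt n)"

lemma ln_fact_eq_sum_ln: "ln (fact N :: real) = (\<Sum>n\<in>{1..N}. ln (real n))"
  by (induction N) (simp_all add: ln_mult add.commute)

lemma ln_fact_eq_sum_mangoldt: "ln (fact N) = (\<Sum>d\<in>{1..N}. mangoldt d * real (N div d))"
proof -
  have "ln (fact N :: real) = (\<Sum>n\<in>{1..N}. ln (real n))"
    by (rule ln_fact_eq_sum_ln)
  then show ?thesis
    using sum_mult_ln_eq_sum_mangoldt[of "\<lambda>_. 1" N] by simp
qed

text \<open>Chebyshev's argument: the logarithm of the central binomial coefficient is the sum of
  \<open>mangoldt d\<close> with weights \<open>2 * n div d - 2 * (n div d)\<close>. These are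
  nonnegative, and at least 1 for \<open>n < d \<le> 2 * n\<close>, while the coefficient is at most
  \<open>2 ^ (2 * n)\<close>.\<close>

lemma \<psi>_double: "\<psi> (2 * n) \<le> \<psi> n + 2 * real n"
proof -
  have "\<psi> (2 * n) - \<psi> n = (\<Sum>d\<in>{n<..2*n}. mangoldt d)"
    unfolding \<psi>_def by (rule sum_greaterThanAtMost_eq_diff [symmetric]) simp
  also have "\<dots> \<le> (\<Sum>d\<in>{n<..2*n}. mangoldt d * (real (2 * n div d) - 2 * real (n div d)))"
  proof (rule sum_mono)
    fix d assume "d \<in> {n<..2*n}"
    then have "n div d = 0" "2 * n div d \<ge> 1"
      by (auto simp: less_eq_div_iff_mult_less_eq)
    then show "mangoldt d \<le> mangoldt d * (real (2 * n div d) - 2 * real (n div d))"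
      using mangoldt_nonneg[of d] by (auto intro!: mult_left_le[of _ "mangoldt d", THEN order_trans] mult_le_cancel_left1[THEN iffD2])
  qed
  also have "\<dots> \<le> (\<Sum>d\<in>{1..2*n}. mangoldt d * (real (2 * n div d) - 2 * real (n div d)))"
  proof (rule sum_mono2)
    fix d assume "d \<in> {1..2*n} - {n<..2*n}"
    then have "d > 0" by auto
    then have "2 * (n div d) \<le> 2 * n div d"
      by (simp add: less_eq_div_iff_mult_less_eq mult.assoc)
    then have "2 * real (n div d) \<le> real (2 * n div d)" by linarith
    then show "0 \<le> mangoldt d * (real (2 * n div d) - 2 * real (n div d))"
      using mangoldt_nonneg[of d] by simp
  qed auto
  also have "\<dots> = ln (fact (2 * n)) - 2 * (\<Sum>d\<in>{1..2*n}. mangoldt d * real (n div d))"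
    unfolding ln_fact_eq_sum_mangoldt by (simp add: sum_subtractf sum_distrib_left algebra_simps)
  also have "(\<Sum>d\<in>{1..2*n}. mangoldt d * real (n div d)) = ln (fact n)"
    unfolding ln_fact_eq_sum_mangoldt by (rule sum.mono_neutral_right) auto
  also have "ln (fact (2 * n)) - 2 * ln (fact n) = ln (real (2 * n choose n))"
    by (simp add: binomial_fact ln_div ln_mult)
  also have "\<dots> \<le> ln (2 ^ (2 * n))"
  proof -
    have "real (2 * n choose n) \<le> real (2 ^ (2 * n))"
      by (subst of_nat_le_iff) (rule binomial_le_pow2)
    then show ?thesis
      by (subst ln_le_cancel_iff) auto
  qed
  also have "\<dots> = 2 * n * ln 2" by (simp add: ln_realpow)
  also have "\<dots> \<le> real (2 * n) * 1" by (intro mult_left_mono) (auto simp: ln_2_less_1 less_imp_le)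
  finally show ?thesis by simp
qed

text \<open>Repeated halving. Even \<open>n\<close> would allow the constant 3; the slack up to 4
  absorbs the extra term \<open>mangoldt n \<le> n - 1\<close> for odd \<open>n\<close>.\<close>

lemma \<psi>_le: "\<psi> n \<le> 4 * real n"
proof (induction n rule: less_induct)
  case (less n)
  show ?case
  proof (cases "n = 0")
    case True then show ?thesis by (simp add: \<psi>_def)
  next
    case False
    then have "\<psi> (n div 2) \<le> 4 * real (n div 2)" by (intro less.IH) auto
    then have d: "\<psi> (2 * (n div 2)) \<le> 6 * real (n div 2)" using \<psi>_double[of "n div 2"] by simp
    show ?thesis
    proof (cases "even n")
      case True
      then show ?thesis using d by (auto elim!: evenE)
    next
      case odd: False
      then obtain m where m: "n = Suc (2 * m)" by (auto elim!: oddE)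
      have "\<psi> n = \<psi> (2 * m) + mangoldt n"
        unfolding m \<psi>_def by simp
      moreover have "mangoldt n \<le> ln (real n)" using mangoldt_le[of n] False by simp
      moreover have "ln (real n) \<le> real n - 1" using False by (intro ln_le_minus_one) simp
      ultimately show ?thesis using d m by simp
    qed
  qed
qed

section \<open>Mertens' first theorem and its analogue for a character\<close>

lemma ln_fact_ge: "ln (fact n :: real) \<ge> n * ln n - n"
proof (induction n)
  case (Suc n)
  show ?case
  proof (cases "n = 0")
    case False
    have "n * ln (real (Suc n)) \<le> n * ln (real n) + 1"
      using ln_Suc_le[of n] False by (simp add: field_simps)
    moreover have "ln (fact (Suc n) :: real) = ln (Suc n) + ln (fact n)"
      by (simp add: ln_mult)
    ultimately show ?thesis
      using Suc by (simp add: algebra_simps)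
  qed simp
qed simp

lemma ln_fact_le: "ln (fact n :: real) \<le> n * ln n"
proof (cases "n = 0")
  case False
  have "ln (fact n :: real) = (\<Sum>k\<in>{1..n}. ln (real k))"
    by (rule ln_fact_eq_sum_ln)
  also have "\<dots> \<le> (\<Sum>k\<in>{1..n}. ln (real n))"
    by (intro sum_mono) auto
  finally show ?thesis by simp
qed simp

text \<open>Dropping the integer parts in the expansion of \<open>ln (fact N)\<close> costs at most
  \<open>\<psi> N \<le> 4 * N\<close>, and \<open>ln (fact N)\<close> lies between
  \<open>N * ln N - N\<close> and \<open>N * ln N\<close>.\<close>

lemma sum_mangoldt_over_bounds:
  assumes "N > 0"
  shows "(\<Sum>d\<in>{1..N}. mangoldt d / d) \<le> ln N + 4" "(\<Sum>d\<in>{1..N}. mangoldt d / d) \<ge> ln N - 1"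
proof -
  let ?S = "\<Sum>d\<in>{1..N}. mangoldt d / real d"
  have frac: "real (N div d) \<le> N / d" "N / d \<le> real (N div d) + 1" for d
    using floor_correct[of "real N / real d"] unfolding floor_divide_of_nat_eq by simp_all
  have S: "N * ?S = (\<Sum>d\<in>{1..N}. mangoldt d * (N / d))"
    by (simp add: sum_distrib_left mult.commute)
  have "ln (fact N) \<le> N * ?S"
    unfolding S ln_fact_eq_sum_mangoldt
    by (intro sum_mono mult_left_mono frac mangoldt_nonneg)
  then have "N * (ln N - 1) \<le> N * ?S"
    using ln_fact_ge[of N] by (simp add: algebra_simps)
  then show "?S \<ge> ln N - 1" using assms by simp
  have "N * ?S \<le> (\<Sum>d\<in>{1..N}. mangoldt d * (real (N div d) + 1))"
    unfolding S by (intro sum_mono mult_left_mono frac mangoldt_nonneg)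
  also have "\<dots> = ln (fact N) + \<psi> N"
    unfolding ln_fact_eq_sum_mangoldt \<psi>_def by (simp add: algebra_simps sum.distrib)
  also have "\<dots> \<le> N * ln N + 4 * N"
    using ln_fact_le[of N] \<psi>_le[of N] by simp
  finally have "N * ?S \<le> N * (ln N + 4)" by (simp add: algebra_simps)
  then show "?S \<le> ln N + 4" using assms by simp
qed

text \<open>Summation by parts. The induction follows \<open>S n - A' n * g n\<close>, whose
  increments \<open>A' n * (g n - g (Suc n))\<close> are dominated by a telescoping sum.\<close>

lemma abel_bound:
  fixes a g :: "nat \<Rightarrow> real"
  assumes g: "\<And>k. k > m \<Longrightarrow> g (Suc k) \<le> g k" "\<And>k. k > m \<Longrightarrow> g k \<ge> 0"
    and A: "\<And>n. \<bar>\<Sum>k\<in>{m<..n}. a k\<bar> \<le> B"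
  shows "\<bar>\<Sum>k\<in>{m<..n}. a k * g k\<bar> \<le> B * g (Suc m)"
proof (cases "n > m")
  case False
  have "B \<ge> 0" using A[of m] by simp
  then show ?thesis using False g(2)[of "Suc m"] by simp
next
  case True
  define A' where "A' n = (\<Sum>k\<in>{m<..n}. a k)" for n
  define S where "S n = (\<Sum>k\<in>{m<..n}. a k * g k)" for n
  have ins: "{m<..Suc n} = insert (Suc n) {m<..n}" if "m \<le> n" for n
    using that by auto
  have A'_Suc: "A' (Suc n) = A' n + a (Suc n)" "S (Suc n) = S n + a (Suc n) * g (Suc n)"
    if "m \<le> n" for n
    unfolding A'_def S_def ins[OF that] by auto
  have "\<bar>S n - A' n * g n\<bar> \<le> B * (g (Suc m) - g n)" if "n \<ge> Suc m" for n
    using that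
  proof (induction n rule: dec_induct)
    case base
    have "A' m = 0" "S m = 0" unfolding A'_def S_def by auto
    then show ?case using A'_Suc[of m] by simp
  next
    case (step n)
    have "S (Suc n) - A' (Suc n) * g (Suc n) = (S n - A' n * g n) + A' n * (g n - g (Suc n))"
      using step A'_Suc[of n] by (simp add: algebra_simps)
    also have "\<bar>\<dots>\<bar> \<le> B * (g (Suc m) - g n) + B * (g n - g (Suc n))"
    proof (rule order_trans[OF abs_triangle_ineq add_mono])
      show "\<bar>A' n * (g n - g (Suc n))\<bar> \<le> B * (g n - g (Suc n))"
        using A[of n] g(1)[of n] step unfolding A'_def abs_mult by (auto intro: mult_right_mono)
    qed (use step in auto)
    finally show ?case by (simp add: algebra_simps)
  qed
  from this[of n] True have "\<bar>S n - A' n * g n\<bar> \<le> B * (g (Suc m) - g n)" by simp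
  moreover have "\<bar>A' n * g n\<bar> \<le> B * g n"
    using A[of n] g(2)[of n] True unfolding A'_def abs_mult by (auto intro: mult_right_mono)
  ultimately show ?thesis unfolding S_def by (simp add: algebra_simps)
qed


text \<open>The quadratic character of \<open>\<rat>(\<surd>-2)\<close>.\<close>

definition \<chi> :: "nat \<Rightarrow> real" where
  "\<chi> n = (if n mod 8 \<in> {1, 3} then 1 else if n mod 8 \<in> {5, 7} then -1 else 0)"

lemma mod_8_cases: "(n :: nat) mod 8 \<in> {0, 1, 2, 3, 4, 5, 6, 7}"
proof -
  have "n mod 8 \<in> {..<8}" by simp
  then show ?thesis by (auto simp: lessThan_nat_numeral lessThan_Suc)
qed

lemma \<chi>_mult: "\<chi> (a * b) = \<chi> a * \<chi> b"
proof -
  define r s where "r = a mod 8" and "s = b mod 8"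
  have "(a * b) mod 8 = r * s mod 8" by (simp add: mod_mult_eq r_def s_def)
  moreover have "r \<in> {0, 1, 2, 3, 4, 5, 6, 7}" "s \<in> {0, 1, 2, 3, 4, 5, 6, 7}"
    unfolding r_def s_def by (rule mod_8_cases)+
  ultimately show ?thesis
    unfolding \<chi>_def r_def[symmetric] s_def[symmetric] by (elim insertE emptyE) simp_all
qed

lemma sum_\<chi>:
  "(\<Sum>k\<in>{1..n}. \<chi> k) = (if n mod 8 \<in> {0, 7} then 0 else if n mod 8 \<in> {3, 4} then 2 else 1)"
proof (induction n)
  case (Suc n)
  define r where "r = n mod 8"
  have "Suc n mod 8 = (if r = 7 then 0 else Suc r)" by (simp add: mod_Suc r_def)
  moreover have "r \<in> {0, 1, 2, 3, 4, 5, 6, 7}"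
    unfolding r_def by (rule mod_8_cases)
  moreover have "(\<Sum>k\<in>{1..Suc n}. \<chi> k) = (\<Sum>k\<in>{1..n}. \<chi> k) + \<chi> (Suc n)" by simp
  ultimately show ?case
    unfolding Suc \<chi>_def[of "Suc n"] r_def[symmetric] by (elim insertE emptyE) simp_all
qed simp

lemma abs_sum_\<chi>_le: "\<bar>\<Sum>k\<in>{m<..n}. \<chi> k\<bar> \<le> 2"
proof (cases "m \<le> n")
  case True
  then have "(\<Sum>k\<in>{m<..n}. \<chi> k) = (\<Sum>k\<in>{1..n}. \<chi> k) - (\<Sum>k\<in>{1..m}. \<chi> k)"
    by (rule sum_greaterThanAtMost_eq_diff)
  then show ?thesis unfolding sum_\<chi> by simp
qed simp

lemma sum_\<chi>_over_diff:
  assumes "m \<le> n"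
  shows "\<bar>(\<Sum>k\<in>{1..n}. \<chi> k / k) - (\<Sum>k\<in>{1..m}. \<chi> k / k)\<bar> \<le> 2 / Suc m"
proof -
  have "(\<Sum>k\<in>{1..n}. \<chi> k / k) - (\<Sum>k\<in>{1..m}. \<chi> k / k) = (\<Sum>k\<in>{m<..n}. \<chi> k * (1 / k))"
    using sum_greaterThanAtMost_eq_diff[OF assms, of "\<lambda>k. \<chi> k / k"] by simp
  then show ?thesis
    using abel_bound[of m "\<lambda>k. 1 / real k" \<chi> 2 n] abs_sum_\<chi>_le[of m]
    by (simp add: field_simps)
qed

text \<open>An effective form of L(1, \<chi>) > 0: the first three terms give 1 + 1/3, and whatever
  follows them is at most 2/4 in absolute value.\<close>

lemma sum_\<chi>_over_ge:
  assumes "n > 0"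
  shows "(\<Sum>k\<in>{1..n}. \<chi> k / k) \<ge> 1 / 2"
proof (cases "n \<ge> 3")
  case True
  have "{1..3} = {1, 2, 3 :: nat}" by auto
  then have "(\<Sum>k\<in>{1..3}. \<chi> k / k) = 4 / 3" by (simp add: \<chi>_def)
  moreover have "\<bar>(\<Sum>k\<in>{1..n}. \<chi> k / k) - (\<Sum>k\<in>{1..3}. \<chi> k / k)\<bar> \<le> 1 / 2"
    using sum_\<chi>_over_diff[OF True] by simp
  ultimately show ?thesis by linarith
next
  case False
  then have "n = 1 \<or> n = 2" using assms by auto
  moreover have "{1..2} = {1, 2 :: nat}" by auto
  then have "(\<Sum>k\<in>{1..2}. \<chi> k / k) = 1" by (simp add: \<chi>_def)
  ultimately show ?thesis by (auto simp: \<chi>_def)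
qed

lemma ln_over_antimono:
  assumes "k \<ge> 3"
  shows "ln (Suc k) / Suc k \<le> ln k / k"
proof -
  have "exp 1 \<le> real k" using exp_le assms by linarith
  then have "1 \<le> ln k" using assms by (subst ln_ge_iff) auto
  moreover have "k * (ln (Suc k) - ln k) \<le> 1"
    using ln_Suc_le[of k] assms by (simp add: field_simps)
  ultimately have "k * (ln (Suc k) - ln k) \<le> ln k" by linarith
  then show ?thesis using assms by (simp add: field_simps)
qed

lemma sum_\<chi>_ln_over_le: "\<bar>\<Sum>k\<in>{1..n}. \<chi> k / k * ln k\<bar> \<le> 2"
proof -
  \<comment> \<open>The terms at 1 and 2 vanish because \<open>ln 1 = 0\<close> and
    \<open>\<chi> 2 = 0\<close>; from 3 on, \<open>ln k / k\<close> decreases.\<close>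
  have eq: "(\<Sum>k\<in>{1..n}. \<chi> k / k * ln k) = (\<Sum>k\<in>{2<..n}. \<chi> k * (ln k / k))"
  proof (rule sum.mono_neutral_cong_right)
    show "\<forall>i\<in>{1..n} - {2<..n}. \<chi> i / i * ln i = 0"
    proof
      fix i assume "i \<in> {1..n} - {2<..n}"
      then have "i = 1 \<or> i = 2" by auto
      then show "\<chi> i / i * ln i = 0" by (auto simp: \<chi>_def)
    qed
  qed auto
  have "\<bar>\<Sum>k\<in>{2<..n}. \<chi> k * (ln k / k)\<bar> \<le> 2 * (ln (Suc 2) / Suc 2)"
    by (rule abel_bound) (use ln_over_antimono abs_sum_\<chi>_le in auto)
  also have "ln (real (Suc 2)) \<le> real (Suc 2) - 1" by (intro ln_le_minus_one) simp
  finally show ?thesis unfolding eq by simp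
qed

text \<open>The convolution identity bounds \<open>?Y\<close>, in which each term carries the factor
  \<open>?S (N div d)\<close>, by 2. Replacing this factor by \<open>?S N\<close> costs at most
  \<open>2 / N * \<psi> N \<le> 8\<close> in total, and \<open>?S N \<ge> 1 / 2\<close> can be
  divided out, whence 2 * (2 + 8) = 20.\<close>

lemma sum_\<chi>_mangoldt_over_bound:
  assumes "N > 0"
  shows "\<bar>\<Sum>d\<in>{1..N}. \<chi> d * mangoldt d / d\<bar> \<le> 20"
proof -
  let ?S = "\<lambda>n. \<Sum>k\<in>{1..n}. \<chi> k / real k"
  let ?X = "\<Sum>d\<in>{1..N}. \<chi> d * mangoldt d / real d"
  let ?Y = "\<Sum>d\<in>{1..N}. \<chi> d * mangoldt d / real d * ?S (N div d)"
  have "?Y = (\<Sum>n\<in>{1..N}. \<chi> n / n * ln n)"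
    using sum_mult_ln_eq_sum_mangoldt[of "\<lambda>n. \<chi> n / n" N] by (simp add: \<chi>_mult mult_ac)
  then have Y: "\<bar>?Y\<bar> \<le> 2" using sum_\<chi>_ln_over_le by simp
  have "?X * ?S N - ?Y = (\<Sum>d\<in>{1..N}. \<chi> d * mangoldt d / d * (?S N - ?S (N div d)))"
    unfolding sum_distrib_right sum_subtractf[symmetric] by (simp add: right_diff_distrib)
  also have "\<bar>\<dots>\<bar> \<le> (\<Sum>d\<in>{1..N}. 2 / N * mangoldt d)"
  proof (rule order_trans[OF sum_abs sum_mono])
    fix d assume d: "d \<in> {1..N}"
    have "N / d < real (N div d) + 1"
      using floor_correct[of "real N / real d"] unfolding floor_divide_of_nat_eq by simp
    then have "N < d * (real (N div d) + 1)" using d by (simp add: field_simps)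
    then have "2 / Suc (N div d) \<le> 2 * d / N"
      using d by (simp add: field_simps)
    moreover have "\<bar>?S N - ?S (N div d)\<bar> \<le> 2 / Suc (N div d)"
      by (rule sum_\<chi>_over_diff) simp
    ultimately have "\<bar>?S N - ?S (N div d)\<bar> \<le> 2 * d / N" by linarith
    moreover have "\<bar>\<chi> d * mangoldt d / d\<bar> \<le> mangoldt d / d"
      using mangoldt_nonneg[of d] by (auto simp: \<chi>_def abs_mult)
    ultimately have "\<bar>\<chi> d * mangoldt d / d\<bar> * \<bar>?S N - ?S (N div d)\<bar> \<le> mangoldt d / d * (2 * d / N)"
      using mangoldt_nonneg[of d] by (intro mult_mono) auto
    then show "\<bar>\<chi> d * mangoldt d / d * (?S N - ?S (N div d))\<bar> \<le> 2 / N * mangoldt d"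
      using d by (simp add: abs_mult mult.commute)
  qed
  also have "\<dots> = 2 / N * \<psi> N" by (simp add: \<psi>_def sum_distrib_left)
  also have "\<dots> \<le> 2 / N * (4 * N)" using \<psi>_le[of N] by (intro mult_left_mono) auto
  also have "\<dots> = 8" using assms by simp
  finally have "\<bar>?X * ?S N\<bar> \<le> 10" using Y by linarith
  moreover have "\<bar>?X\<bar> * (1 / 2) \<le> \<bar>?X\<bar> * \<bar>?S N\<bar>"
    using sum_\<chi>_over_ge[OF assms] by (intro mult_left_mono) auto
  ultimately show ?thesis unfolding abs_mult by linarith
qed

section \<open>Squarefree products of primes from a given set\<close>

lemma squarefree_eq_prod_prime_factors:
  fixes n :: nat
  assumes "squarefree n"
  shows "n = \<Prod>(prime_factors n)"
proof -
  have "n \<noteq> 0" using assms by (metis not_squarefree_0)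
  then have "n = (\<Prod>p\<in>prime_factors n. p ^ multiplicity p n)"
    by (intro prime_factorization_nat) simp
  also have "\<dots> = (\<Prod>p\<in>prime_factors n. p)"
  proof (rule prod.cong[OF refl])
    fix p assume "p \<in> prime_factors n"
    then have "multiplicity p n > 0" "multiplicity p n \<le> 1"
      using assms \<open>n \<noteq> 0\<close> by (auto simp: squarefree_factorial_semiring'' prime_factors_multiplicity)
    then have "multiplicity p n = 1" by simp
    then show "p ^ multiplicity p n = p" by simp
  qed
  finally show ?thesis .
qed

lemma prime_factors_prod_primes:
  fixes A :: "nat set"
  assumes "finite A" "\<And>p. p \<in> A \<Longrightarrow> prime p"
  shows "prime_factors (\<Prod>A) = A" "squarefree (\<Prod>A)"
proof -
  have "prime_factors (\<Prod>A) = A \<and> squarefree (\<Prod>A) \<and> \<Prod>A > 0"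
    using assms
  proof (induction A rule: finite_induct)
    case (insert p A)
    then have p: "prime p" and IH: "prime_factors (\<Prod>A) = A" "squarefree (\<Prod>A)" "\<Prod>A > 0" by auto
    have "\<not> p dvd \<Prod>A"
      using insert.hyps IH p by (metis in_prime_factors_iff neq0_conv less_numeral_extra(3))
    then have "coprime p (\<Prod>A)" using p by (simp add: prime_imp_coprime)
    then show ?case
      using IH p insert.hyps
      by (auto simp: squarefree_mult_coprime squarefree_prime prime_factors_product prime_prime_factors prime_gt_0_nat)
  qed auto
  then show "prime_factors (\<Prod>A) = A" "squarefree (\<Prod>A)" by auto
qed

definition sqfree_over :: "nat set \<Rightarrow> nat set" where
  "sqfree_over S = {n. squarefree n \<and> prime_factors n \<subseteq> S}"

lemma sum_inverse_squares_le: "(\<Sum>m\<in>{1..N}. 1 / real m ^ 2) \<le> 2"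
proof -
  have "(\<Sum>m\<in>{1..N}. 1 / real m ^ 2) \<le> 2 - 1 / N" if "N > 0"
    using that
  proof (induction N rule: nat_induct_non_zero)
    case (Suc n)
    have "1 / real (Suc n) ^ 2 \<le> 1 / (real n * real (Suc n))"
      using Suc.hyps unfolding power2_eq_square by (intro frac_le mult_right_mono) auto
    also have "\<dots> = 1 / n - 1 / Suc n"
      using Suc.hyps by (simp add: field_simps)
    finally show ?case using Suc.IH by simp
  qed simp
  then show ?thesis by (cases "N = 0") (auto intro: order_trans)
qed

text \<open>Each \<open>n\<close> is a product of a square, a squarefree number over
  \<open>S\<close> and a squarefree number over the complement, and these three determine
  \<open>n\<close>. So every \<open>1 / n\<close> occurs in the expanded triple product; the factor
  2 bounds the sum of inverse squares.\<close>

lemma sum_inverse_le_mult_sqfree_over: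
  "(\<Sum>n\<in>{1..N}. 1 / real n) \<le>
    2 * (\<Sum>n\<in>{1..N} \<inter> sqfree_over S. 1 / real n) * (\<Sum>n\<in>{1..N} \<inter> sqfree_over (- S). 1 / real n)"
proof -
  let ?A = "{1..N} \<inter> sqfree_over S" and ?B = "{1..N} \<inter> sqfree_over (- S)"
  define a b where "a n = \<Prod>(prime_factors (squarefree_part n) \<inter> S)"
    and "b n = \<Prod>(prime_factors (squarefree_part n) - S)" for n :: nat
  have n: "n = a n * b n * square_part n ^ 2" for n
  proof -
    have "squarefree_part n = \<Prod>(prime_factors (squarefree_part n))"
      by (intro squarefree_eq_prod_prime_factors) auto
    also have "\<dots> = a n * b n"
      unfolding a_def b_def by (subst prod.union_disjoint[symmetric]) (auto intro: arg_cong[where f = Prod])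
    finally show ?thesis using squarefree_decompose[of n] by metis
  qed
  have in_over: "a n \<in> sqfree_over S" "b n \<in> sqfree_over (- S)" for n
    unfolding sqfree_over_def a_def b_def
    by (subst mem_Collect_eq, subst prime_factors_prod_primes; auto intro!: prime_factors_prod_primes(2))+
  let ?h = "\<lambda>n. (square_part n, a n, b n)"
  let ?w = "\<lambda>(m, a, b). 1 / real m ^ 2 * (1 / real a * (1 / real b))"
  have "(\<Sum>n\<in>{1..N}. 1 / real n) = (\<Sum>n\<in>{1..N}. ?w (?h n))"
  proof (rule sum.cong[OF refl])
    fix k assume "k \<in> {1..N}"
    have "real k = real (a k) * real (b k) * real (square_part k) ^ 2"
      using arg_cong[OF n[of k], of real] by simp
    then show "1 / real k = ?w (?h k)" by (simp add: field_simps)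
  qed
  also have "\<dots> = sum ?w (?h ` {1..N})"
  proof (rule sum.reindex_cong[symmetric, OF _ refl refl])
    show "inj_on ?h {1..N}" by (rule inj_onI) (metis n prod.inject)
  qed
  also have "\<dots> \<le> sum ?w ({1..N} \<times> (?A \<times> ?B))"
  proof (rule sum_mono2)
    show "?h ` {1..N} \<subseteq> {1..N} \<times> (?A \<times> ?B)"
    proof
      fix x assume "x \<in> ?h ` {1..N}"
      then obtain k where k: "x = ?h k" "k \<in> {1..N}" by blast
      have "a k dvd k" "b k dvd k" by (subst (2) n; simp)+
      moreover have "square_part k dvd k"
        by (metis dvd_mult dvd_power dvd_refl n pos2)
      ultimately show "x \<in> {1..N} \<times> (?A \<times> ?B)"
        using k in_over[of k] by (auto simp: Suc_le_eq dvd_pos_nat intro: order_trans[OF dvd_imp_le])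
    qed
  qed auto
  also have "\<dots> = (\<Sum>m\<in>{1..N}. 1 / real m ^ 2) * ((\<Sum>n\<in>?A. 1 / real n) * (\<Sum>n\<in>?B. 1 / real n))"
    by (simp only: sum_product sum.cartesian_product case_prod_unfold fst_conv snd_conv)
  also have "\<dots> \<le> 2 * ((\<Sum>n\<in>?A. 1 / real n) * (\<Sum>n\<in>?B. 1 / real n))"
    by (intro mult_right_mono sum_inverse_squares_le mult_nonneg_nonneg sum_nonneg) auto
  finally show ?thesis by simp
qed

text \<open>A squarefree number is determined by its set of primes, so the sum is part of the
  expansion of the product of the factors 1 + 1/p, each at most exp (1/p).\<close>

lemma sum_sqfree_over_le:
  "(\<Sum>n\<in>{1..N} \<inter> sqfree_over S. 1 / real n) \<le> exp (\<Sum>p\<in>{p\<in>S. prime p \<and> p \<le> N}. 1 / real p)"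
proof -
  let ?P = "{p\<in>S. prime p \<and> p \<le> N}"
  have fin: "finite ?P" by simp
  have "(\<Sum>n\<in>{1..N} \<inter> sqfree_over S. 1 / real n) =
    (\<Sum>n\<in>{1..N} \<inter> sqfree_over S. \<Prod>p\<in>prime_factors n. 1 / real p)"
  proof (rule sum.cong[OF refl])
    fix n assume "n \<in> {1..N} \<inter> sqfree_over S"
    then have "real n = real (\<Prod>(prime_factors n))"
      using squarefree_eq_prod_prime_factors[of n] by (simp add: sqfree_over_def)
    then show "1 / real n = (\<Prod>p\<in>prime_factors n. 1 / real p)"
      by (simp add: prod_dividef)
  qed
  also have "\<dots> = (\<Sum>X\<in>prime_factors ` ({1..N} \<inter> sqfree_over S). \<Prod>p\<in>X. 1 / real p)"
  proof (rule sum.reindex_cong[symmetric, OF _ refl refl])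
    show "inj_on prime_factors ({1..N} \<inter> sqfree_over S)"
      by (rule inj_onI) (metis (mono_tags, lifting) IntD2 mem_Collect_eq sqfree_over_def squarefree_eq_prod_prime_factors)
  qed
  also have "\<dots> \<le> (\<Sum>X\<in>Pow ?P. \<Prod>p\<in>X. 1 / real p)"
    by (rule sum_mono2)
      (auto simp: sqfree_over_def intro!: prod_nonneg dest: dvd_imp_le intro: order_trans[OF dvd_imp_le])
  also have "\<dots> = (\<Prod>p\<in>?P. 1 / real p + 1)"
    by (subst prod_add[OF fin]) simp
  also have "\<dots> \<le> (\<Prod>p\<in>?P. exp (1 / real p))"
    by (intro prod_mono) (simp add: add.commute exp_ge_add_one_self)
  also have "\<dots> = exp (\<Sum>p\<in>?P. 1 / real p)"
    using fin by (simp add: exp_sum)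
  finally show ?thesis .
qed

text \<open>Summation by parts as a comparison principle; with the weight \<open>1 / ln k\<close> it
  leads from sums of ln p / p to sums of 1/p.\<close>

lemma sum_mult_antimono_le:
  fixes a b g :: "nat \<Rightarrow> real"
  assumes le: "\<And>n. m \<le> n \<Longrightarrow> sum a {m..n} \<le> sum b {m..n}"
    and g: "\<And>n. m \<le> n \<Longrightarrow> g (Suc n) \<le> g n" "\<And>n. m \<le> n \<Longrightarrow> g n \<ge> 0" and "m \<le> n"
  shows "(\<Sum>k\<in>{m..n}. a k * g k) \<le> (\<Sum>k\<in>{m..n}. b k * g k)"
proof -
  define e where "e k = b k - a k" for k
  have e: "sum e {m..n} \<ge> 0" if "m \<le> n" for n
    using le[OF that] by (simp add: e_def sum_subtractf)
  have "(\<Sum>k\<in>{m..n}. e k * g k) \<ge> sum e {m..n} * g n"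
    using \<open>m \<le> n\<close>
  proof (induction n rule: dec_induct)
    case (step n)
    have "sum e {m..Suc n} * g (Suc n) = sum e {m..n} * g (Suc n) + e (Suc n) * g (Suc n)"
      using step by (simp add: algebra_simps)
    also have "\<dots> \<le> sum e {m..n} * g n + e (Suc n) * g (Suc n)"
      using step e g by (intro add_right_mono mult_left_mono) auto
    also have "\<dots> \<le> (\<Sum>k\<in>{m..Suc n}. e k * g k)"
      using step by simp
    finally show ?case .
  qed simp
  moreover have "sum e {m..n} * g n \<ge> 0" using e g \<open>m \<le> n\<close> by simp
  ultimately have "(\<Sum>k\<in>{m..n}. e k * g k) \<ge> 0" by linarith
  then show ?thesis by (simp add: e_def left_diff_distrib sum_subtractf)
qed

section \<open>Primes congruent to 1 or 3 modulo 8\<close>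

lemma sum_ln_over_square_le: "(\<Sum>n\<in>{1..N}. ln (real n) / real n ^ 2) \<le> 2"
proof -
  \<comment> \<open>This sharper bound telescopes: the term at \<open>Suc n\<close> is at most the
    drop of \<open>(ln n + 2) / n\<close> from \<open>n\<close> to \<open>Suc n\<close>.\<close>
  have "(\<Sum>n\<in>{1..N}. ln (real n) / real n ^ 2) \<le> 2 - (ln N + 2) / N" if "N > 0"
    using that
  proof (induction N rule: nat_induct_non_zero)
    case (Suc n)
    have "ln (real (Suc n)) / real (Suc n) ^ 2 \<le> ln (real (Suc n)) / (real n * real (Suc n))"
      using Suc.hyps unfolding power2_eq_square by (intro frac_le mult_right_mono mult_pos_pos) auto
    also have "\<dots> \<le> (ln n + 2 - n * (ln (real (Suc n)) - ln n)) / (real n * real (Suc n))"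
    proof (intro divide_right_mono)
      have "n * (ln (real (Suc n)) - ln n) \<le> 1"
        using ln_Suc_le[of n] Suc.hyps by (simp add: field_simps)
      moreover have "ln (real (Suc n)) \<le> ln n + 1"
        using order_trans[OF ln_Suc_le[OF Suc.hyps], of "ln n + 1"] Suc.hyps by simp
      ultimately show "ln (real (Suc n)) \<le> ln n + 2 - n * (ln (real (Suc n)) - ln n)"
        by linarith
    qed simp
    also have "\<dots> = (ln n + 2) / n - (ln (real (Suc n)) + 2) / Suc n"
      using Suc.hyps by (simp add: divide_simps) (simp add: algebra_simps)
    finally show ?case using Suc.IH by simp
  qed simp
  moreover have "(ln N + 2) / N \<ge> 0" by (cases "N = 0") auto
  ultimately show ?thesis by (cases "N = 0") (simp, linarith)
qed

lemma sum_powers_ge_2_le: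
  fixes x :: real
  assumes "0 \<le> x" "x \<le> 1 / 2"
  shows "(\<Sum>k\<in>{2..N}. x ^ k) \<le> 2 * x ^ 2"
proof (cases "N \<ge> 2")
  case True
  \<comment> \<open>The added \<open>x ^ N\<close> makes the induction close, since
    \<open>2 * x ^ Suc n \<le> x ^ n\<close>.\<close>
  then have "(\<Sum>k\<in>{2..N}. x ^ k) + x ^ N \<le> 2 * x ^ 2"
  proof (induction N rule: dec_induct)
    case (step n)
    have "2 * x ^ Suc n \<le> x ^ n"
      using assms mult_right_mono[of "2 * x" 1 "x ^ n"] by simp
    then show ?case using step by simp
  qed simp
  moreover have "x ^ N \<ge> 0" using assms by simp
  ultimately show ?thesis by linarith
next
  case False
  then show ?thesis using assms by simp
qed

text \<open>Only powers \<open>p ^ k\<close> with \<open>k \<ge> 2\<close> contribute; the geometric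
  sum over \<open>k\<close> is at most \<open>2 * ln p / p^2\<close>.\<close>

lemma sum_mangoldt_nonprime_le:
  "(\<Sum>n\<in>{n\<in>{1..N}. \<not> prime n}. mangoldt n / real n) \<le> 4"
proof -
  let ?I = "{p\<in>{1..N}. prime p} \<times> {2..N}"
  let ?f = "\<lambda>(p, k). p ^ k"
  let ?g = "\<lambda>n. mangoldt n / real n"
  have nonneg: "?g n \<ge> 0" for n using mangoldt_nonneg[of n] by simp
  have "sum ?g {n\<in>{1..N}. \<not> prime n} = sum ?g {n\<in>{1..N}. \<not> prime n \<and> primepow n}"
    by (rule sum.mono_neutral_right) (auto simp: mangoldt_def)
  also have "\<dots> \<le> sum ?g (?f ` ?I)"
  proof (rule sum_mono2)
    show "{n\<in>{1..N}. \<not> prime n \<and> primepow n} \<subseteq> ?f ` ?I"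
    proof
      fix n assume n: "n \<in> {n\<in>{1..N}. \<not> prime n \<and> primepow n}"
      then obtain p k where pk: "prime p" "k > 0" "n = p ^ k" by (auto simp: primepow_def)
      have "k \<noteq> 1" using n pk by auto
      then have "k \<ge> 2" using pk by simp
      moreover have "p \<le> p ^ k" using pk by (simp add: self_le_power prime_gt_0_nat Suc_leI)
      moreover have "k < p ^ k"
        using prime_gt_1_nat[OF pk(1)] by (simp add: power_gt_expt)
      ultimately have "(p, k) \<in> ?I"
        using n pk prime_gt_0_nat[OF pk(1)] by auto
      then show "n \<in> ?f ` ?I" unfolding pk(3) by (rule rev_image_eqI) simp
    qed
  qed (use nonneg in auto)
  also have "\<dots> \<le> sum (?g \<circ> ?f) ?I"
    by (rule sum_image_le) (use nonneg in auto)
  also have "\<dots> = (\<Sum>p\<in>{p\<in>{1..N}. prime p}. \<Sum>k\<in>{2..N}. ln (real p) * (1 / real p) ^ k)"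
    unfolding sum.cartesian_product
    by (intro sum.cong refl) (auto simp: power_divide)
  also have "\<dots> \<le> (\<Sum>p\<in>{p\<in>{1..N}. prime p}. 2 * (ln (real p) / real p ^ 2))"
  proof (rule sum_mono)
    fix p assume "p \<in> {p\<in>{1..N}. prime p}"
    then have p: "prime p" by simp
    have "(\<Sum>k\<in>{2..N}. ln (real p) * (1 / real p) ^ k) = ln (real p) * (\<Sum>k\<in>{2..N}. (1 / real p) ^ k)"
      by (simp add: sum_distrib_left)
    also have "\<dots> \<le> ln (real p) * (2 * (1 / real p) ^ 2)"
      using prime_ge_2_nat[OF p] by (intro mult_left_mono sum_powers_ge_2_le) (auto simp: field_simps)
    finally show "(\<Sum>k\<in>{2..N}. ln (real p) * (1 / real p) ^ k) \<le> 2 * (ln (real p) / real p ^ 2)"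
      by (simp add: power_divide mult_ac)
  qed
  also have "\<dots> \<le> (\<Sum>p\<in>{1..N}. 2 * (ln (real p) / real p ^ 2))"
    by (rule sum_mono2) auto
  also have "\<dots> = 2 * (\<Sum>p\<in>{1..N}. ln (real p) / real p ^ 2)"
    by (rule sum_distrib_left [symmetric])
  also have "\<dots> \<le> 4"
    using sum_ln_over_square_le[of N] by simp
  finally show ?thesis .
qed

text \<open>The prime 3 is left out so that it can be used later to adjust residues modulo 8.\<close>

definition split_primes :: "nat set" where
  "split_primes = {p. prime p \<and> (p mod 8 = 1 \<or> p mod 8 = 3) \<and> p \<noteq> 3}"

lemma sum_indicator_2_3_le: "(\<Sum>n\<in>{1..N}. if n \<in> {2, 3 :: nat} then 1 else 0 :: real) \<le> 2"
proof -
  have "(\<Sum>n\<in>{1..N}. if n \<in> {2, 3 :: nat} then 1 else 0 :: real) = card ({1..N} \<inter> {2, 3})"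
    by (subst sum.inter_restrict[symmetric]) simp_all
  also have "card ({1..N} \<inter> {2, 3}) \<le> card {2, 3 :: nat}"
    by (rule card_mono) auto
  finally show ?thesis by simp
qed

lemma odd_prime_mod_8:
  fixes p :: nat
  assumes "prime p" "p \<noteq> 2"
  shows "p mod 8 \<in> {1, 3, 5, 7}"
proof -
  have "odd p" using assms by (metis prime_odd_nat prime_ge_2_nat le_neq_implies_less)
  then have "odd (p mod 8)" by (simp add: dvd_mod_iff)
  then show ?thesis using mod_8_cases[of p] by auto
qed

lemma ln_over_le_1: "n > 0 \<Longrightarrow> ln (real n) / n \<le> 1"
  using ln_le_minus_one[of "real n"] by (simp add: field_simps)

text \<open>The weight \<open>(1 + \<chi> n) / 2\<close> is 1 on the residues 1 and 3, 1/2 on even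
  numbers and 0 elsewhere, so half the sum of the two Mertens estimates applies: errors (4 + 20)/2 =
  12 above and (1 + 20)/2 < 11 below. The lower bound loses a further 4 to nonprimes and 2 to the
  primes 2 and 3.\<close>

lemma sum_ln_split_primes_bounds:
  fixes N :: nat
  assumes "N > 0"
  shows "(\<Sum>p\<in>{p\<in>{1..N}. p \<in> split_primes}. ln (real p) / p) \<le> ln N / 2 + 12"
    and "(\<Sum>p\<in>{p\<in>{1..N}. p \<in> split_primes}. ln (real p) / p) \<ge> ln N / 2 - 17"
proof -
  define h where "h n = (1 + \<chi> n) / 2 * (mangoldt n / real n)" for n
  have h0: "h n \<ge> 0" for n using mangoldt_nonneg[of n] by (auto simp: h_def \<chi>_def)
  have "sum h {1..N} = (\<Sum>n\<in>{1..N}. mangoldt n / n) / 2 + (\<Sum>n\<in>{1..N}. \<chi> n * mangoldt n / n) / 2"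
    by (simp add: h_def sum_divide_distrib sum.distrib[symmetric] field_simps)
  then have h: "sum h {1..N} \<le> ln N / 2 + 12" "sum h {1..N} \<ge> ln N / 2 - 11"
    using sum_mangoldt_over_bounds[OF assms] sum_\<chi>_mangoldt_over_bound[OF assms] by linarith+
  have eq: "h p = ln (real p) / p" if "p \<in> split_primes" for p
    using that by (auto simp: split_primes_def h_def \<chi>_def)
  have "(\<Sum>p\<in>{p\<in>{1..N}. p \<in> split_primes}. ln (real p) / p) = sum h {p\<in>{1..N}. p \<in> split_primes}"
    by (rule sum.cong) (simp_all add: eq)
  also have "\<dots> \<le> sum h {1..N}"
    by (rule sum_mono2) (auto simp: h0)
  finally show "(\<Sum>p\<in>{p\<in>{1..N}. p \<in> split_primes}. ln (real p) / p) \<le> ln N / 2 + 12"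
    using h by simp
  have "sum h {1..N} \<le> (\<Sum>n\<in>{1..N}. (if n \<in> split_primes then ln (real n) / n else 0) +
     (if \<not> prime n then mangoldt n / real n else 0) + (if n \<in> {2, 3} then 1 else 0))"
  proof (rule sum_mono)
    fix n assume "n \<in> {1..N}"
    then have n: "n > 0" by simp
    let ?R = "(if n \<in> split_primes then ln (real n) / n else 0) +
     (if \<not> prime n then mangoldt n / real n else 0) + (if n \<in> {2, 3} then 1 else 0 :: real)"
    consider "n \<in> split_primes" | "\<not> prime n" | "n \<in> {2, 3}" | "prime n" "n mod 8 \<in> {5, 7}"
      using odd_prime_mod_8[of n] by (auto simp: split_primes_def)
    then show "h n \<le> ?R"
    proof cases
      case 1
      then show ?thesis using eq by (auto simp: split_primes_def)
    next
      case 2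
      have "h n \<le> 1 * (mangoldt n / real n)"
        unfolding h_def using mangoldt_nonneg[of n] by (intro mult_right_mono) (auto simp: \<chi>_def)
      then show ?thesis using 2 by (auto simp: split_primes_def)
    next
      case 3
      have "h n \<le> 1 * (mangoldt n / real n)"
        unfolding h_def using mangoldt_nonneg[of n] by (intro mult_right_mono) (auto simp: \<chi>_def)
      also have "\<dots> \<le> ln n / n" using mangoldt_le[OF n] by (simp add: divide_right_mono)
      also have "\<dots> \<le> 1" by (rule ln_over_le_1[OF n])
      finally show ?thesis using 3 by (auto simp: split_primes_def)
    next
      case 4
      then have "h n = 0" by (auto simp: h_def \<chi>_def)
      moreover have "?R \<ge> 0" using mangoldt_nonneg[of n] n by auto
      ultimately show ?thesis by simp
    qed
  qed
  also have "\<dots> = (\<Sum>p\<in>{p\<in>{1..N}. p \<in> split_primes}. ln (real p) / p) +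
      (\<Sum>n\<in>{n\<in>{1..N}. \<not> prime n}. mangoldt n / real n) + (\<Sum>n\<in>{1..N}. if n \<in> {2, 3 :: nat} then 1 else 0)"
    by (simp only: sum.distrib sum.inter_filter finite_atLeastAtMost)
  finally show "(\<Sum>p\<in>{p\<in>{1..N}. p \<in> split_primes}. ln (real p) / p) \<ge> ln N / 2 - 17"
    using h sum_mangoldt_nonprime_le[of N] sum_indicator_2_3_le[of N] by linarith
qed

text \<open>The complementary weight \<open>(1 - \<chi> n) / 2\<close> gives 12; it undercounts 2
  and 3, which add at most 1 each.\<close>

lemma sum_ln_nonsplit_primes_le:
  fixes N :: nat
  assumes "N > 0"
  shows "(\<Sum>p\<in>{p\<in>{1..N}. prime p \<and> p \<notin> split_primes}. ln (real p) / p) \<le> ln N / 2 + 14"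
proof -
  define h where "h n = (1 - \<chi> n) / 2 * (mangoldt n / real n)" for n
  have h0: "h n \<ge> 0" for n using mangoldt_nonneg[of n] by (auto simp: h_def \<chi>_def)
  have "sum h {1..N} = (\<Sum>n\<in>{1..N}. mangoldt n / n) / 2 - (\<Sum>n\<in>{1..N}. \<chi> n * mangoldt n / n) / 2"
    by (simp add: h_def sum_divide_distrib sum_subtractf[symmetric] field_simps)
  then have h: "sum h {1..N} \<le> ln N / 2 + 12"
    using sum_mangoldt_over_bounds[OF assms] sum_\<chi>_mangoldt_over_bound[OF assms] by linarith
  have "(\<Sum>p\<in>{p\<in>{1..N}. prime p \<and> p \<notin> split_primes}. ln (real p) / p) \<le>
    (\<Sum>p\<in>{p\<in>{1..N}. prime p \<and> p \<notin> split_primes}. h p + (if p \<in> {2, 3} then 1 else 0))"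
  proof (rule sum_mono)
    fix p assume p: "p \<in> {p\<in>{1..N}. prime p \<and> p \<notin> split_primes}"
    show "ln (real p) / p \<le> h p + (if p \<in> {2, 3} then 1 else 0)"
    proof (cases "p \<in> {2, 3}")
      case True
      then show ?thesis using ln_over_le_1[of p] h0[of p] by auto
    next
      case False
      then have "p mod 8 \<in> {5, 7}" using p odd_prime_mod_8[of p] by (auto simp: split_primes_def)
      then show ?thesis using p by (auto simp: h_def \<chi>_def)
    qed
  qed
  also have "\<dots> \<le> (\<Sum>p\<in>{1..N}. h p + (if p \<in> {2, 3} then 1 else 0))"
    by (rule sum_mono2) (auto simp: h0 intro!: add_nonneg_nonneg)
  finally show ?thesis
    using h sum_indicator_2_3_le[of N] by (simp add: sum.distrib)
qed

text \<open>Mertens' second theorem for these primes, by partial summation with weight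
  \<open>1 / ln k\<close>; the increments of the majorant are at most half those of ln ln.\<close>

lemma sum_inverse_nonsplit_primes_le:
  "\<exists>C. \<forall>N\<ge>2. (\<Sum>p\<in>{p\<in>- split_primes. prime p \<and> p \<le> N}. 1 / real p) \<le> ln (ln (real N)) / 2 + C"
proof -
  \<comment> \<open>The value that gives equality for the majorant at \<open>N = 2\<close>.\<close>
  define C :: real where "C = (ln 2 / 2 + 14) / ln 2 - ln (ln 2) / 2"
  define a where "a k = (if prime k \<and> k \<notin> split_primes then ln (real k) / k else 0)" for k :: nat
  \<comment> \<open>Chosen so that its partial sums are exactly the bound
    \<open>ln n / 2 + 14\<close>.\<close>
  define b where "b k = (if k = 2 then ln 2 / 2 + 14 else (ln (real k) - ln (real (k - 1))) / 2)" for k :: nat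
  have sum_b: "sum b {2..n} = ln n / 2 + 14" if "2 \<le> n" for n
    using that
  proof (induction n rule: dec_induct)
    case (step n)
    then show ?case by (simp add: b_def field_simps)
  qed (simp add: b_def)
  have sum_a: "sum a {2..n} \<le> ln n / 2 + 14" if "2 \<le> n" for n
  proof -
    have "sum a {2..n} = (\<Sum>p\<in>{p\<in>{2..n}. prime p \<and> p \<notin> split_primes}. ln (real p) / p)"
      unfolding a_def by (rule sum.inter_filter[symmetric]) simp
    also have "{p\<in>{2..n}. prime p \<and> p \<notin> split_primes} = {p\<in>{1..n}. prime p \<and> p \<notin> split_primes}"
      by (auto simp: Suc_le_eq prime_gt_0_nat prime_ge_2_nat)
    finally show ?thesis using sum_ln_nonsplit_primes_le[of n] that by simp
  qed
  have "(\<Sum>p\<in>{p\<in>- split_primes. prime p \<and> p \<le> N}. 1 / real p) \<le> ln (ln (real N)) / 2 + C"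
    if N: "N \<ge> 2" for N
  proof -
    have "(\<Sum>p\<in>{p\<in>- split_primes. prime p \<and> p \<le> N}. 1 / real p) =
        (\<Sum>p\<in>{p\<in>{2..N}. prime p \<and> p \<notin> split_primes}. 1 / real p)"
      by (rule sum.cong) (auto dest: prime_ge_2_nat)
    also have "\<dots> = (\<Sum>k\<in>{2..N}. a k * (1 / ln k))"
      by (subst sum.inter_filter) (auto simp: a_def intro!: sum.cong)
    also have "\<dots> \<le> (\<Sum>k\<in>{2..N}. b k * (1 / ln k))"
      by (rule sum_mult_antimono_le) (use N sum_a sum_b in \<open>auto intro!: divide_left_mono\<close>)
    also have "\<dots> \<le> ln (ln N) / 2 + C"
      using N
    proof (induction N rule: dec_induct)
      case (step n)
      let ?u = "ln (real (Suc n))" and ?v = "ln (real n)"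
      have uv: "?u > 0" "?v > 0" using step by auto
      have "ln (?v / ?u) \<le> ?v / ?u - 1"
        using uv by (intro ln_le_minus_one) simp
      then have le: "(?u - ?v) / ?u \<le> ln ?u - ln ?v"
        using uv by (simp add: ln_div diff_divide_distrib)
      have "(\<Sum>k\<in>{2..Suc n}. b k * (1 / ln k)) = (\<Sum>k\<in>{2..n}. b k * (1 / ln k)) + (?u - ?v) / ?u / 2"
        using step by (simp add: b_def)
      also have "\<dots> \<le> ln ?v / 2 + C + (ln ?u - ln ?v) / 2"
        by (intro add_mono step.IH divide_right_mono le) simp
      finally show ?case by (simp add: field_simps)
    qed (simp add: b_def C_def)
    finally show ?thesis .
  qed
  then show ?thesis by blast
qed

section \<open>From the sum of reciprocals to a count of admissible integers\<close>

lemma ln_le_sum_inverse: "n > 0 \<Longrightarrow> ln (real n) \<le> (\<Sum>k\<in>{1..n}. 1 / real k)"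
proof -
  have "ln (real (Suc n)) \<le> (\<Sum>k\<in>{1..n}. 1 / real k)" for n
  proof (induction n)
    case (Suc n)
    then show ?case using ln_Suc_le[of "Suc n"] by simp
  qed simp
  moreover assume "n > 0"
  then have "ln (real n) \<le> ln (real (Suc n))" by simp
  ultimately show ?thesis by (rule order_trans[rotated])
qed

text \<open>In the factorisation of the harmonic sum, which is at least \<open>ln N\<close>, the
  part over the other primes is at most a constant times \<open>sqrt (ln N)\<close>; the split
  primes must supply the rest.\<close>

lemma sum_sqfree_over_split_primes_ge:
  "\<exists>c>0. \<forall>N\<ge>2. (\<Sum>n\<in>{1..N} \<inter> sqfree_over split_primes. 1 / real n) \<ge> c * sqrt (ln (real N))"
proof -
  obtain C where C: "\<forall>N\<ge>2. (\<Sum>p\<in>{p\<in>- split_primes. prime p \<and> p \<le> N}. 1 / real p) \<le> ln (ln (real N)) / 2 + C"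
    using sum_inverse_nonsplit_primes_le by blast
  show ?thesis
  proof (intro exI conjI allI impI)
    show "1 / (2 * exp C) > 0" by simp
    fix N :: nat assume N: "N \<ge> 2"
    let ?F = "\<Sum>n\<in>{1..N} \<inter> sqfree_over split_primes. 1 / real n"
    have pos: "ln N > 0" using N by simp
    have "(\<Sum>n\<in>{1..N} \<inter> sqfree_over (- split_primes). 1 / real n) \<le> exp (ln (ln N) / 2 + C)"
      using order_trans[OF sum_sqfree_over_le] C N exp_le_cancel_iff by blast
    also have "\<dots> = exp C * sqrt (ln N)"
      using pos by (simp add: exp_add ln_sqrt[symmetric])
    finally have Q: "(\<Sum>n\<in>{1..N} \<inter> sqfree_over (- split_primes). 1 / real n) \<le> exp C * sqrt (ln N)" .
    have "sqrt (ln N) * sqrt (ln N) = ln N" using pos by simp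
    also have "ln N \<le> (\<Sum>n\<in>{1..N}. 1 / real n)" using N by (intro ln_le_sum_inverse) simp
    also have "\<dots> \<le> 2 * ?F * (\<Sum>n\<in>{1..N} \<inter> sqfree_over (- split_primes). 1 / real n)"
      by (rule sum_inverse_le_mult_sqfree_over)
    also have "\<dots> \<le> 2 * ?F * (exp C * sqrt (ln N))"
      by (intro mult_left_mono Q) (simp add: sum_nonneg)
    finally have "sqrt (ln N) * sqrt (ln N) \<le> (2 * ?F * exp C) * sqrt (ln N)" by (simp add: mult_ac)
    then have "sqrt (ln N) \<le> 2 * ?F * exp C"
      by (rule mult_right_le_imp_le) (use pos in simp)
    then show "?F \<ge> 1 / (2 * exp C) * sqrt (ln N)"
      by (simp add: field_simps)
  qed
qed

text \<open>The main terms at the two endpoints differ by at least \<open>ln K / 2 \<ge> 30\<close>,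
  while the errors amount to 17 + 12 = 29; hence the threshold 60.\<close>

lemma sum_ln_split_primes_interval_ge:
  fixes y K :: nat
  assumes "y \<ge> K" "K > 0" "ln (real K) \<ge> 60"
  shows "(\<Sum>p\<in>{p\<in>{y div K<..y}. p \<in> split_primes}. ln (real p) / p) \<ge> 1"
proof -
  let ?f = "\<lambda>p :: nat. if p \<in> split_primes then ln (real p) / p else 0"
  have z: "y div K > 0" using assms by (simp add: div_greater_zero_iff)
  have "real (y div K) * K \<le> y"
    by (metis div_times_less_eq_dividend of_nat_le_iff of_nat_mult)
  then have "ln (real (y div K) * K) \<le> ln (real y)"
    using z assms by (subst ln_le_cancel_iff) auto
  then have le: "ln (real (y div K)) + ln K \<le> ln (real y)"
    using z assms by (simp add: ln_mult_pos)
  have "(\<Sum>p\<in>{p\<in>{y div K<..y}. p \<in> split_primes}. ln (real p) / p) = sum ?f {y div K<..y}"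
    by (rule sum.inter_filter) simp
  also have "\<dots> = sum ?f {1..y} - sum ?f {1..y div K}"
    by (rule sum_greaterThanAtMost_eq_diff) simp
  finally have eq: "(\<Sum>p\<in>{p\<in>{y div K<..y}. p \<in> split_primes}. ln (real p) / p) =
      sum ?f {1..y} - sum ?f {1..y div K}" .
  moreover have "sum ?f {1..y} \<ge> ln y / 2 - 17"
    using sum_ln_split_primes_bounds(2)[of y] assms by (subst sum.inter_filter[symmetric]) simp_all
  moreover have "sum ?f {1..y div K} \<le> ln (y div K) / 2 + 12"
    using sum_ln_split_primes_bounds(1)[OF z] by (subst sum.inter_filter[symmetric]) simp_all
  ultimately show ?thesis using le assms(3) by linarith
qed

text \<open>A prime above \<open>y div K\<close> contributes at most \<open>K * ln y / y\<close> to
  a sum that is at least 1.\<close>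

lemma card_split_primes_interval_ge:
  fixes y K :: nat
  assumes "y \<ge> K" "K > 1" "ln (real K) \<ge> 60"
  shows "real (card {p\<in>{y div K<..y}. p \<in> split_primes}) \<ge> y / (K * ln y)"
proof -
  let ?P = "{p\<in>{y div K<..y}. p \<in> split_primes}"
  have y: "y > 1" "ln (real y) > 0" using assms by auto
  have "1 \<le> (\<Sum>p\<in>?P. ln (real p) / p)"
    using sum_ln_split_primes_interval_ge[of K y] assms by simp
  also have "\<dots> \<le> real (card ?P) * (K * ln y / y)"
  proof (rule sum_bounded_above)
    fix p assume p: "p \<in> ?P"
    then have "y < p * K" using assms by (simp add: div_less_iff_less_mult)
    then have "real y \<le> p * K" by (metis less_imp_le of_nat_le_iff of_nat_mult)
    moreover have "p > 0" "ln (real p) \<le> ln (real y)" "ln (real p) \<ge> 0" using p by auto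
    ultimately have "ln (real p) * y \<le> ln (real y) * (p * K)"
      using y by (intro mult_mono) auto
    then show "ln (real p) / p \<le> K * ln y / y"
      using \<open>p > 0\<close> y by (simp add: field_simps)
  qed
  finally show ?thesis using y assms by (simp add: field_simps)
qed

text \<open>The products \<open>n p\<close> with \<open>n \<le> M < p\<close> are pairwise distinct, because \<open>p\<close> is the only prime factor
  exceeding \<open>M\<close>.\<close>

lemma card_sqfree_over_split_primes_ge_sum:
  assumes K: "K > 1" "ln (real K) \<ge> 60" and M: "M > 0" "M * M * K \<le> x"
  shows "real (card ({1..x} \<inter> sqfree_over split_primes)) \<ge>
    x / (2 * real K * ln x) * (\<Sum>n\<in>{1..M} \<inter> sqfree_over split_primes. 1 / real n)"
proof -
  let ?T = "{1..M} \<inter> sqfree_over split_primes"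
  let ?P = "\<lambda>n. {p\<in>{x div n div K<..x div n}. p \<in> split_primes}"
  let ?I = "SIGMA n:?T. ?P n"
  \<comment> \<open>The room \<open>M * M * K \<le> x\<close> ensures that every prime in
    \<open>?P n\<close> exceeds \<open>M\<close>.\<close>
  have le: "M \<le> x div n div K" "K \<le> x div n" "n \<le> x" if "n \<in> ?T" for n
  proof -
    have n: "0 < n" "n \<le> M" using that by auto
    then have "M * K * n \<le> M * M * K" by (simp add: mult_ac)
    then have "M * K * n \<le> x" using M by linarith
    then have "M * K \<le> x div n" using n by (simp add: less_eq_div_iff_mult_less_eq)
    then show "M \<le> x div n div K" "K \<le> x div n"
      using K M by (auto simp: less_eq_div_iff_mult_less_eq intro: order_trans[of K "M * K"])
    then show "n \<le> x" using K n by (metis div_less leD not_less zero_less_one less_trans)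
  qed
  have "inj_on (\<lambda>(n, p). n * p) ?I"
  proof (rule inj_onI, clarify)
    fix n p n' p'
    assume n: "n \<in> {1..M}" "n \<in> sqfree_over split_primes" "n' \<in> {1..M}" "n' \<in> sqfree_over split_primes"
      and p: "p \<in> {x div n div K<..x div n}" "p \<in> split_primes"
        "p' \<in> {x div n' div K<..x div n'}" "p' \<in> split_primes"
      and eq: "n * p = n' * p'"
    have "prime p" "prime p'" using p by (auto simp: split_primes_def)
    have "p > M" using le[of n] n p by simp
    then have "\<not> p dvd n'" using n by (auto dest!: dvd_imp_le)
    moreover have "p dvd n' * p'" using eq by (metis dvd_triv_right)
    ultimately have "p dvd p'" using \<open>prime p\<close> by (simp add: prime_dvd_mult_iff)
    then have "p = p'" using \<open>prime p\<close> \<open>prime p'\<close> by (rule primes_dvd_imp_eq[rotated 2])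
    then show "n = n' \<and> p = p'" using eq \<open>prime p\<close> by (simp add: prime_gt_0_nat)
  qed
  then have "card ?I = card ((\<lambda>(n, p). n * p) ` ?I)"
    by (simp add: card_image)
  also have "\<dots> \<le> card ({1..x} \<inter> sqfree_over split_primes)"
  proof (rule card_mono)
    show "(\<lambda>(n, p). n * p) ` ?I \<subseteq> {1..x} \<inter> sqfree_over split_primes"
    proof clarify
      fix n p assume n: "n \<in> {1..M}" "n \<in> sqfree_over split_primes"
        and p: "p \<in> {x div n div K<..x div n}" "p \<in> split_primes"
      have prime: "prime p" using p by (auto simp: split_primes_def)
      have "p > M" using le[of n] n p by simp
      then have "\<not> p dvd n" using n by (auto dest!: dvd_imp_le)
      then have "coprime n p" using prime by (metis prime_imp_coprime coprime_commute)
      then have "n * p \<in> sqfree_over split_primes"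
        using n p prime by (auto simp: sqfree_over_def squarefree_mult_coprime squarefree_prime
            prime_factors_product prime_prime_factors prime_gt_0_nat)
      moreover have "n * p \<le> x"
        using n p by (simp add: less_eq_div_iff_mult_less_eq mult.commute)
      ultimately show "n * p \<in> {1..x} \<inter> sqfree_over split_primes"
        using n prime_gt_0_nat[OF prime] by simp
    qed
  qed simp
  finally have "real (card ({1..x} \<inter> sqfree_over split_primes)) \<ge> (\<Sum>n\<in>?T. real (card (?P n)))"
    by (simp flip: of_nat_sum)
  moreover have "(\<Sum>n\<in>?T. real (card (?P n))) \<ge> (\<Sum>n\<in>?T. x / (2 * real K * ln x) * (1 / real n))"
  proof (rule sum_mono)
    fix n assume n: "n \<in> ?T"
    let ?y = "x div n"
    have pos: "?y > 1" "n > 0" "ln (real ?y) > 0" using le[OF n] K n by auto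
    \<comment> \<open>Rounding \<open>x / n\<close> down costs at most a factor 2, since
      \<open>?y > 1\<close>.\<close>
    have "x / n < real ?y + 1"
      using floor_correct[of "real x / real n"] unfolding floor_divide_of_nat_eq by simp
    then have "x / n \<le> 2 * real ?y" using pos by linarith
    moreover have "ln (real ?y) \<le> ln (real x)"
      using pos by (subst ln_le_cancel_iff) (auto intro: Nat.gr0I)
    ultimately have "(x / n / 2) / (K * ln x) \<le> ?y / (K * ln ?y)"
      using pos K by (intro frac_le mult_left_mono mult_pos_pos) auto
    also have "\<dots> \<le> real (card (?P n))"
      by (rule card_split_primes_interval_ge) (use le[OF n] K in auto)
    finally show "x / (2 * real K * ln x) * (1 / real n) \<le> real (card (?P n))"
      by (simp add: mult_ac)
  qed
  ultimately show ?thesis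
    unfolding sum_distrib_left by linarith
qed

text \<open>With \<open>M\<close> near the fourth root of \<open>x\<close>, both
  \<open>M * M * K \<le> x\<close> for \<open>x \<ge> K^2\<close> and
  \<open>ln M \<ge> ln x / 8\<close> hold, so x / ln x times \<open>sqrt (ln M)\<close> has the
  order of x / \<open>sqrt (ln x)\<close>.\<close>

lemma card_sqfree_over_split_primes_ge:
  "\<exists>c>0. \<exists>x0. \<forall>x\<ge>x0. real (card ({1..x} \<inter> sqfree_over split_primes)) \<ge> c * x / sqrt (ln (real x))"
proof -
  obtain c where c: "c > 0"
    "\<forall>N\<ge>2. (\<Sum>n\<in>{1..N} \<inter> sqfree_over split_primes. 1 / real n) \<ge> c * sqrt (ln (real N))"
    using sum_sqfree_over_split_primes_ge by blast
  \<comment> \<open>The least integer meeting the threshold \<open>ln K \<ge> 60\<close>.\<close>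
  define K where "K = nat \<lceil>exp 60 :: real\<rceil>"
  have K: "real K \<ge> exp 60" by (simp add: K_def)
  then have lnK: "ln (real K) \<ge> 60"
    using exp_gt_zero[of "60 :: real"] by (subst ln_ge_iff) linarith+
  have K61: "real K \<ge> 61" using K exp_ge_add_one_self[of 60] by linarith
  then have K1: "K > 1" by linarith
  have "real (card ({1..x} \<inter> sqfree_over split_primes)) \<ge> c / (2 * real K * sqrt 8) * x / sqrt (ln (real x))"
    if x: "x \<ge> K ^ 2" for x
  proof -
    define r where "r = sqrt (sqrt (real x))"
    define M where "M = nat \<lfloor>r\<rfloor>"
    have "61 ^ 2 \<le> real K ^ 2" using K61 by (intro power_mono) auto
    also have "\<dots> \<le> real x" using x by (metis of_nat_le_iff of_nat_power)
    finally have x61: "real x \<ge> 61 ^ 2" by simp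
    have sx: "sqrt x \<ge> K" using x by (metis of_nat_0_le_iff of_nat_le_iff of_nat_power real_le_rsqrt)
    then have r: "r \<ge> sqrt 61" unfolding r_def using K61 by simp
    then have r7: "r \<ge> 7" using real_le_rsqrt[of 7 61] by simp
    have M: "real M \<le> r" "real M \<ge> r - 1"
      unfolding M_def using r7 by (simp, linarith)
    then have M2: "M \<ge> 2" "real M \<ge> r / 2" using r7 by linarith+
    have "real M * real M \<le> r * r" using M by (intro mult_mono) auto
    also have "r * r = sqrt x" by (simp add: r_def)
    finally have "real M * real M * real K \<le> sqrt x * sqrt x"
      using sx by (intro mult_mono) auto
    then have "real (M * M * K) \<le> real x" by simp
    then have MK: "M * M * K \<le> x" by (simp only: of_nat_le_iff)
    have "ln r = ln x / 4"
      using x61 by (simp add: r_def ln_sqrt)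
    moreover have "ln (r / 2) \<le> ln M"
      using M2 r7 by (subst ln_le_cancel_iff) auto
    moreover have "ln (r / 2) = ln r - ln 2" using r7 by (simp add: ln_div)
    \<comment> \<open>This pays for the factor 2 lost in rounding \<open>r\<close> down to
      \<open>M\<close>: \<open>ln x / 4 - ln 2 \<ge> ln x / 8\<close>.\<close>
    moreover have "ln x / 8 \<ge> ln 2"
    proof -
      have "ln (2 ^ 8) \<le> ln (real x)" using x61 by (subst ln_le_cancel_iff) auto
      moreover have "ln (2 ^ 8 :: real) = 8 * ln 2" by (subst ln_realpow) simp_all
      ultimately show ?thesis by linarith
    qed
    ultimately have lnM: "ln M \<ge> ln x / 8" by linarith
    have lnx: "ln (real x) > 0" using x61 by simp
    have "c / (2 * real K * sqrt 8) * x / sqrt (ln (real x)) = x / (2 * real K * ln x) * (c * sqrt (ln x / 8))"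
      using lnx K1 real_sqrt_mult_self[of "ln x"] by (simp add: real_sqrt_divide field_simps)
    also have "\<dots> \<le> x / (2 * real K * ln x) * (\<Sum>n\<in>{1..M} \<inter> sqfree_over split_primes. 1 / real n)"
    proof (rule mult_left_mono)
      have "c * sqrt (ln x / 8) \<le> c * sqrt (ln M)"
        using lnM c by (intro mult_left_mono real_sqrt_le_mono) auto
      then show "c * sqrt (ln x / 8) \<le> (\<Sum>n\<in>{1..M} \<inter> sqfree_over split_primes. 1 / real n)"
        using c(2) M2(1) by fastforce
      show "0 \<le> x / (2 * real K * ln x)" using lnx by simp
    qed
    also have "\<dots> \<le> real (card ({1..x} \<inter> sqfree_over split_primes))"
      by (rule card_sqfree_over_split_primes_ge_sum[OF K1 lnK _ MK]) (use M2 in simp)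
    finally show ?thesis .
  qed
  moreover have "c / (2 * real K * sqrt 8) > 0" using c K1 by simp
  ultimately show ?thesis by blast
qed

section \<open>Counting fields\<close>

text \<open>Multiplication by 3 moves the residue 1 to the residue 3 modulo 8 that the twist
  demands.\<close>

definition twist_param :: "nat \<Rightarrow> nat" where
  "twist_param n = (if n mod 8 = 3 then n else 3 * n)"

lemma sqfree_over_split_primes_mod_8:
  assumes "n \<in> sqfree_over split_primes"
  shows "n mod 8 = 1 \<or> n mod 8 = 3"
proof -
  have n: "squarefree n" "prime_factors n \<subseteq> split_primes"
    using assms by (auto simp: sqfree_over_def)
  have "(\<Prod>p\<in>A. p) mod 8 \<in> {1, 3}" if "finite A" "A \<subseteq> split_primes" for A :: "nat set"
    using that
  proof (induction A rule: finite_induct)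
    case (insert p A)
    then have "p mod 8 \<in> {1, 3}" "\<Prod>A mod 8 \<in> {1, 3}" by (auto simp: split_primes_def)
    moreover have "(p * \<Prod>A) mod 8 = (p mod 8) * (\<Prod>A mod 8) mod 8" by (simp add: mod_mult_eq)
    ultimately show ?case using insert.hyps by auto
  qed simp
  from this[of "prime_factors n"] show ?thesis
    using squarefree_eq_prod_prime_factors[OF n(1)] n by auto
qed

lemma three_not_dvd_sqfree_over_split_primes:
  assumes "n \<in> sqfree_over split_primes"
  shows "\<not> 3 dvd n"
proof
  assume "3 dvd n"
  moreover have "n \<noteq> 0"
    using assms not_squarefree_0 by (metis (mono_tags, lifting) mem_Collect_eq sqfree_over_def)
  ultimately have "3 \<in> prime_factors n"
    by (simp add: in_prime_factors_iff)
  then show False using assms by (auto simp: sqfree_over_def split_primes_def)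
qed

lemma twist_param_props:
  assumes "n \<in> sqfree_over split_primes"
  shows "squarefree (twist_param n)" "twist_param n mod 8 = 3"
    "\<And>p. prime p \<Longrightarrow> p dvd twist_param n \<Longrightarrow> p mod 8 = 1 \<or> p mod 8 = 3"
proof -
  have n: "squarefree n" "prime_factors n \<subseteq> split_primes"
    using assms by (auto simp: sqfree_over_def)
  then have "n \<noteq> 0" by (metis not_squarefree_0)
  have "coprime 3 n"
    using three_not_dvd_sqfree_over_split_primes[OF assms] by (intro prime_imp_coprime) auto
  then show "squarefree (twist_param n)"
    using n by (auto simp: twist_param_def squarefree_mult_coprime squarefree_prime)
  show "twist_param n mod 8 = 3"
    using sqfree_over_split_primes_mod_8[OF assms] mod_mult_right_eq[of 3 n 8]
    by (auto simp: twist_param_def)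
  fix p :: nat assume p: "prime p" "p dvd twist_param n"
  then have "p dvd 3 \<or> p dvd n"
    by (auto simp: twist_param_def prime_dvd_mult_iff split: if_splits)
  then have "p = 3 \<or> p \<in> prime_factors n"
    using p \<open>n \<noteq> 0\<close> primes_dvd_imp_eq[of p 3] by (auto simp: in_prime_factors_iff)
  then show "p mod 8 = 1 \<or> p mod 8 = 3"
    using n by (auto simp: split_primes_def)
qed

text \<open>Divisibility of the value by 3 tells the two cases of the definition apart.\<close>

lemma inj_on_twist_param: "inj_on twist_param (sqfree_over split_primes)"
proof (rule inj_onI)
  fix m n assume "m \<in> sqfree_over split_primes" "n \<in> sqfree_over split_primes" "twist_param m = twist_param n"
  then show "m = n"
    using three_not_dvd_sqfree_over_split_primes[of m] three_not_dvd_sqfree_over_split_primes[of n]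
    by (auto simp: twist_param_def split: if_splits)
qed

lemma squarefree_int:
  assumes "squarefree n"
  shows "squarefree (int n)"
proof (rule squarefreeI)
  fix x assume "x ^ 2 dvd int n"
  then have "nat \<bar>x\<bar> ^ 2 dvd n"
    by (metis abs_ge_zero int_dvd_int_iff nat_0_le of_nat_power power2_abs)
  then have "nat \<bar>x\<bar> dvd 1" using assms by (rule squarefreeD[rotated])
  then show "x dvd 1" by simp
qed

text \<open>For \<open>q = twist_param n\<close> the field is Q(sqrt(2q)), of discriminant
  \<open>8 * q\<close> because 2q is even; \<open>q \<le> 3 * N\<close> then explains the
  24.\<close>

lemma R_count_ge:
  assumes "24 * real N \<le> X"
  shows "R_count X \<ge> card ({1..N} \<inter> sqfree_over split_primes)"
proof -
  let ?T = "{1..N} \<inter> sqfree_over split_primes"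
  let ?D = "{d :: int. squarefree d \<and> d > 1 \<and> real_of_int (field_disc d) \<le> X \<and>
      (\<exists>E. elliptic_curve_over d E \<and> everywhere_good d E \<and> j_inv E \<in> \<rat>)}"
  let ?f = "\<lambda>n. 2 * int (twist_param n)"
  \<comment> \<open>Essential, because \<open>card\<close> of an infinite set is 0.\<close>
  have "finite ?D"
  proof (rule finite_subset)
    show "?D \<subseteq> {0..\<lfloor>X\<rfloor>}"
      by (auto simp: field_disc_def le_floor_iff split: if_splits)
  qed simp
  have "?f ` ?T \<subseteq> ?D"
  proof (rule image_subsetI)
    fix n assume "n \<in> ?T"
    then have n: "n \<in> {1..N}" "n \<in> sqfree_over split_primes" by auto
    define q where "q = int (twist_param n)"
    have q8: "q mod 8 = 3"
      using twist_param_props(2)[OF n(2)] unfolding q_def by (metis of_nat_mod of_nat_numeral)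
    obtain x z where xz: "q = z ^ 2 + 2 * x ^ 2" "coprime z x" "x mod 4 = 3"
      using squarefree_eq_sq_plus_two_sq[OF twist_param_props[OF n(2)]] unfolding q_def by metis
    have "odd q" using q8 by presburger
    have "squarefree (2 * q)"
    proof (rule squarefree_mult_coprime)
      show "coprime 2 q" using \<open>odd q\<close> by simp
      show "squarefree (2 :: int)" by (rule squarefree_prime) simp
      show "squarefree q" 
        using twist_param_props(1)[OF n(2)] unfolding q_def by (rule squarefree_int)
    qed
    moreover have "q > 0" using twist_param_props(2)[OF n(2)] unfolding q_def by (auto intro: Nat.gr0I)
    moreover have "field_disc (2 * q) = 8 * q"
      unfolding field_disc_def using \<open>odd q\<close> by presburger
    moreover have "q \<le> 3 * int N"
      using n unfolding q_def twist_param_def by auto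
    then have "real_of_int (8 * q) \<le> X" using assms by linarith
    moreover have "\<exists>E. elliptic_curve_over (2 * q) E \<and> everywhere_good (2 * q) E \<and> j_inv E \<in> \<rat>"
      using everywhere_good_twist[OF xz(1) q8 xz(3,2)] by blast
    ultimately show "2 * int (twist_param n) \<in> ?D"
      unfolding q_def[symmetric] mem_Collect_eq by simp
  qed
  then have "card (?f ` ?T) \<le> card ?D"
    using \<open>finite ?D\<close> by (rule card_mono[rotated])
  moreover have "card (?f ` ?T) = card ?T"
    using inj_on_subset[OF inj_on_twist_param] by (intro card_image) (auto simp: inj_on_def)
  ultimately show ?thesis unfolding R_count_def by simp
qed

theorem theorem1p1:
  shows "\<exists>c > 0. \<forall>\<^sub>F X in at_top. real (R_count X) \<ge> c * X / sqrt (ln X)"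
proof -
  obtain c x0 where c: "c > 0"
    "\<And>x. x \<ge> x0 \<Longrightarrow> real (card ({1..x} \<inter> sqfree_over split_primes)) \<ge> c * x / sqrt (ln (real x))"
    using card_sqfree_over_split_primes_ge by blast
  have "real (R_count X) \<ge> c / 48 * X / sqrt (ln X)" if X: "X \<ge> 24 * (real x0 + 3)" for X
  proof -
    \<comment> \<open>The largest \<open>N\<close> with \<open>24 * N \<le> X\<close>. The lower
      bound on \<open>X\<close> yields \<open>N \<ge> x0\<close>, a loss of at most a factor 2 in
      rounding, and \<open>N \<ge> 2\<close>, which keeps \<open>sqrt (ln N)\<close>
      positive.\<close>
    define N where "N = nat \<lfloor>X / 24\<rfloor>"
    have N: "real N \<le> X / 24" "X / 24 - 1 \<le> real N"
    proof -
      have "real N = of_int \<lfloor>X / 24\<rfloor>"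
        unfolding N_def using X by simp
      then show "real N \<le> X / 24" "X / 24 - 1 \<le> real N" by linarith+
    qed
    have "X / 24 \<ge> real x0 + 3" using X by simp
    then have N2: "N \<ge> x0" "N \<ge> 2" "X / 48 \<le> real N"
      using N by linarith+
    have "c / 48 * X / sqrt (ln X) \<le> c * N / sqrt (ln (real N))"
      using N N2 X c(1) by (intro frac_le real_sqrt_le_mono) (auto simp: field_simps)
    also have "\<dots> \<le> real (card ({1..N} \<inter> sqfree_over split_primes))"
      by (rule c(2)) (rule N2)
    also have "\<dots> \<le> real (R_count X)"
      using R_count_ge[of N X] N by simp
    finally show ?thesis .
  qed
  then have "\<forall>\<^sub>F X in at_top. real (R_count X) \<ge> c / 48 * X / sqrt (ln X)"
    unfolding eventually_at_top_linorder by blast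
  moreover have "c / 48 > 0" using c by simp
  ultimately show ?thesis by blast
qed

end
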